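(* Let $|q|<1$ and let $k\geq 4$ be an integer. Then \[ \sum_{m_1,\dots,m_{k-2}\geq 0} \frac{q^{m_1^2+\cdots+m_{k-3}^2+m_{k-3}m_{k-2}}}{(q)_{2m_1}} \Bigl(\prod_{j=2}^{k-3}\begin{bmatrix}m_{j-1}+m_j-m_{j+1}\\ 2m_j\end{bmatrix}\Bigr) \begin{bmatrix}m_{k-3}\\ m_{k-2}\end{bmatrix} =\frac{(q^{F_kF_{k-1}-1},q^{F_kF_{k-1}},q^{2F_kF_{k-1}-1};q^{2F_kF_{k-1}-1})_{\infty}}{(q;q)_{\infty}}. \]
   Context: $F_k$ denotes the Fibonacci numbers: $F_0=0$, $F_1=1$, $F_k=F_{k-1}+F_{k-2}$. $(x;q)_n=\prod_{i=0}^{n-1}(1-xq^i)$ (with $n=\infty$ allowed), $(q)_n=(q;q)_n$, and $(x_1,\dots,x_r;q)_\infty=\prod_{i=1}^r(x_i;q)_\infty$. The $q$-binomial coefficient is $\begin{bmatrix}n\\ m\end{bmatrix}=\frac{(q)_n}{(q)_m(q)_{n-m}}$ if $m$ and $n-m$ are nonnegative integers and $0$ otherwise. An empty product equals $1$. *)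

theory Defs
  imports "HOL-Analysis.Analysis" "HOL-Number_Theory.Fib"
begin

definition qpoch :: "complex \<Rightarrow> complex \<Rightarrow> nat \<Rightarrow> complex" where
  "qpoch x q n = (\<Prod>i<n. (1 - x * q ^ i))"

definition qpochinf :: "complex \<Rightarrow> complex \<Rightarrow> complex" where
  "qpochinf x q = (\<Prod>i. (1 - x * q ^ i))"

definition qbinom :: "complex \<Rightarrow> int \<Rightarrow> int \<Rightarrow> complex" where
  "qbinom q n m = (if 0 \<le> m \<and> m \<le> n
     then qpoch q q (nat n) / (qpoch q q (nat m) * qpoch q q (nat (n - m))) else 0)"

end

(* Write T(y,x;a,b) = [y+a-b; x+a] [y-a+b; x-a]. The q-Saalschuetz sum gives the Burge transform
     sum_i q^(i^2) [y+x-i; 2x] T(x,i;a,b) = q^(a^2) T(y,x;a+b,a),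
   so each summation over one m_i acts on the parameters by the Fibonacci step (a,b) -> (a+b,a).
   The innermost factor q^(x(y-x)) [y;x] is an alternating sum of the T(y,x;j,j), hence the whole
   multisum, with two extra levels 2L and L prepended, is an alternating sum of
   T(2L,L;F_k j,F_(k-1) j) times a quadratic power of q, the squares of the Fibonacci numbers adding
   up to F_k F_(k-1). Letting L tend to infinity produces 1/(q)_inf on the left, 1/(q)_inf^2 on the
   right, and a theta series that the Jacobi triple product evaluates. *)
theory Submission
  imports Defs
begin

text \<open>The obstacle is the denominator \<open>(q)_{2 m_1}\<close>: it has no numerator, so the
  multisum is not itself an iterate of the transform. It becomes one at finite L, because
  \<open>[L + m_1 - m_2; 2 m_1]\<close> tends to \<open>1 / (q)_{2 m_1}\<close>, and a transform
  with middle entry L needs one more entry in front. That entry is 2L so that in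
  \<open>[3L - m_1; 2L]\<close> and in both factors of T(2L, L; a, b) the lower entry and the gap to
  the upper entry tend to infinity. The signs and powers (-1)^j q^(j(j+1)/2) of the alternating sum
  come from a finite triple product with parameters q and 1: its value (q; q)_s (1; q)_s is zero
  unless s = 0. The same finite identity, with other parameters, yields the infinite triple product.
  Both limits are exchanged with the sums by domination. All q-binomials share one bound, and on the
  theta side F_k F_(k-1) - 1 > 0 replaces the parameter 1, for which no geometric majorant exists,
  by a power of q of modulus below 1.\<close>

lemma qpoch_0 [simp]: "qpoch x q 0 = 1"
  by (simp add: qpoch_def)

lemma qpoch_Suc: "qpoch x q (Suc n) = qpoch x q n * (1 - x * q ^ n)"
  by (simp add: qpoch_def)

lemma norm_power_less_1:
  fixes q :: complex
  assumes "norm q < 1" "n > 0"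
  shows "norm (q ^ n) < 1"
  using assms by (simp add: norm_power power_less_one_iff)

lemma qpoch_self_nonzero:
  assumes "norm q < 1"
  shows "qpoch q q n \<noteq> 0"
proof -
  have "q * q ^ i \<noteq> 1" for i
    using norm_power_less_1[OF assms, of "Suc i"] by auto
  then show ?thesis by (simp add: qpoch_def)
qed

section \<open>Gaussian binomial coefficients\<close>

text \<open>Natural arguments make induction and truncated subtraction available for the algebraic
  identities; \<open>qbinom\<close> takes over where an index may become negative.\<close>

definition qb :: "complex \<Rightarrow> nat \<Rightarrow> nat \<Rightarrow> complex" where
  "qb q n k = (if k \<le> n then qpoch q q n / (qpoch q q k * qpoch q q (n - k)) else 0)"

lemma qbinom_of_nat: "qbinom q (int n) (int k) = qb q n k"
  by (auto simp: qbinom_def qb_def nat_diff_distrib)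

lemma qbinom_nat: "0 \<le> n \<Longrightarrow> 0 \<le> k \<Longrightarrow> qbinom q n k = qb q (nat n) (nat k)"
  using qbinom_of_nat[of q "nat n" "nat k"] by simp

lemma qb_eq_0 [simp]: "n < k \<Longrightarrow> qb q n k = 0"
  by (simp add: qb_def)

lemma qb_symmetric: "k \<le> n \<Longrightarrow> qb q n (n - k) = qb q n k"
  by (simp add: qb_def mult.commute)

context
  fixes q :: complex
  assumes q: "norm q < 1"
begin

lemma qb_0_right [simp]: "qb q n 0 = 1"
  using qpoch_self_nonzero[OF q] by (simp add: qb_def)

lemma qb_self [simp]: "qb q n n = 1"
  using qpoch_self_nonzero[OF q] by (simp add: qb_def)

lemma qb_Suc_Suc: "qb q (Suc n) (Suc k) = qb q n k + q ^ Suc k * qb q n (Suc k)"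
proof (cases "Suc k \<le> n")
  case True
  then obtain d where d: "n = Suc k + d" using le_Suc_ex by blast
  have nz: "qpoch q q i \<noteq> 0" for i by (rule qpoch_self_nonzero[OF q])
  have nz2: "1 - q * q ^ i \<noteq> 0" for i
    using nz[of "Suc i"] by (simp add: qpoch_Suc)
  have 1: "Suc n - Suc k = Suc d" "n - k = Suc d" "n - Suc k = d" using d by auto
  have A: "qb q (Suc n) (Suc k) = qpoch q q n * (1 - q * q ^ n) / (qpoch q q k * (1 - q * q ^ k) * (qpoch q q d * (1 - q * q ^ d)))"
    unfolding qb_def using d 1 by (simp add: qpoch_Suc)
  have B: "qb q n k = qpoch q q n / (qpoch q q k * (qpoch q q d * (1 - q * q ^ d)))"
    unfolding qb_def using d 1 by (simp add: qpoch_Suc)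
  have C: "qb q n (Suc k) = qpoch q q n / (qpoch q q k * (1 - q * q ^ k) * qpoch q q d)"
    unfolding qb_def using d 1 by (simp add: qpoch_Suc)
  \<comment> \<open>This splits the factor 1 - q^(n+1) as (1 - q^(k+1)) + q^(k+1) (1 - q^(d+1)),
    which is the rule after cancellation.\<close>
  have n: "q * q ^ n = (q * q ^ k) * (q * q ^ d)" by (simp add: d power_add)
  show ?thesis unfolding A B C using nz[of k] nz[of d] nz2[of k] nz2[of d]
    unfolding n by (simp add: divide_simps) (simp add: algebra_simps)
next
  case False
  then show ?thesis by (cases "k = n") auto
qed

text \<open>The other q-Pascal rule, obtained from \<open>qb_Suc_Suc\<close> by reflecting the lower
  index.\<close>

lemma qb_Suc_Suc': "k \<le> n \<Longrightarrow> qb q (Suc n) (Suc k) = q ^ (n - k) * qb q n k + qb q n (Suc k)"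
proof (cases "k = n")
  case False
  assume "k \<le> n"
  with False obtain d where d: "n = Suc k + d"
    by (metis le_Suc_ex le_neq_implies_less Suc_leI)
  have "qb q (Suc n) (Suc k) = qb q (Suc n) (Suc d)"
    using qb_symmetric[of "Suc k" "Suc n"] d by simp
  also have "\<dots> = qb q n d + q ^ Suc d * qb q n (Suc d)" by (rule qb_Suc_Suc)
  also have "qb q n d = qb q n (Suc k)"
    using qb_symmetric[of "Suc k" n] d by simp
  also have "qb q n (Suc d) = qb q n k"
    using qb_symmetric[of k n] d by simp
  finally show ?thesis using d by simp
qed auto

section \<open>The q-Vandermonde and q-Saalschuetz sums\<close>

text \<open>Induction on x, splitting the coefficients on \<open>Suc x\<close> by
  \<open>qb_Suc_Suc'\<close>. Truncation in the exponent y + k - z is harmless: where the difference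
  would be negative, \<open>qb q y (z - k)\<close> vanishes.\<close>

lemma qb_vandermonde:
  "qb q (x + y) z = (\<Sum>k\<le>z. q ^ (k * (y + k - z)) * qb q x k * qb q y (z - k))"
proof (induction x arbitrary: z)
  case 0
  have "(\<Sum>k\<le>z. q ^ (k * (y + k - z)) * qb q 0 k * qb q y (z - k))
      = (\<Sum>k\<in>{0}. q ^ (k * (y + k - z)) * qb q 0 k * qb q y (z - k))"
    by (rule sum.mono_neutral_right) auto
  then show ?case by simp
next
  case (Suc x)
  show ?case
  proof (cases z)
    case 0
    then show ?thesis by simp
  next
    case (Suc w)
    \<comment> \<open>The second part carries the factor q^(x + y - w), free of k, so both parts can
      be summed by the induction hypothesis, at z and at w.\<close>
    have t: "q ^ (Suc k * (y + Suc k - z)) * qb q (Suc x) (Suc k) * qb q y (z - Suc k)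
        = q ^ (Suc k * (y + Suc k - z)) * qb q x (Suc k) * qb q y (z - Suc k)
        + q ^ (x + y - w) * (q ^ (k * (y + k - w)) * qb q x k * qb q y (w - k))" for k
    proof (cases "k \<le> x \<and> w \<le> y + k")
      case True
      then obtain d e where d: "x = k + d" and e: "y + k = w + e" by (metis le_Suc_ex)
      have "Suc k * (y + Suc k - z) + (x - k) = x + y - w + k * (y + k - w)"
      proof -
        have "y + Suc k - z = e" "y + k - w = e" "x - k = d" using d e Suc by auto
        moreover have "x + y - w = d + e" using d e by simp
        ultimately show ?thesis by simp
      qed
      then have "q ^ (Suc k * (y + Suc k - z)) * q ^ (x - k) = q ^ (x + y - w) * q ^ (k * (y + k - w))"
        by (metis power_add)
      then show ?thesis
        using True Suc by (simp add: qb_Suc_Suc' distrib_left distrib_right)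
    next
      case False
      then show ?thesis using Suc by auto
    qed
    have "(\<Sum>k\<le>z. q ^ (k * (y + k - z)) * qb q (Suc x) k * qb q y (z - k))
        = qb q y z + (\<Sum>k\<le>w. q ^ (Suc k * (y + Suc k - z)) * qb q (Suc x) (Suc k) * qb q y (z - Suc k))"
      unfolding Suc by (subst sum.atMost_Suc_shift) simp
    also have "\<dots> = (qb q y z + (\<Sum>k\<le>w. q ^ (Suc k * (y + Suc k - z)) * qb q x (Suc k) * qb q y (z - Suc k)))
        + q ^ (x + y - w) * qb q (x + y) w"
      unfolding t sum.distrib Suc.IH[of w] sum_distrib_left by simp
    also have "qb q y z + (\<Sum>k\<le>w. q ^ (Suc k * (y + Suc k - z)) * qb q x (Suc k) * qb q y (z - Suc k)) = qb q (x + y) z"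
      unfolding Suc.IH[of z] unfolding Suc by (subst sum.atMost_Suc_shift) simp
    also have "qb q (x + y) z + q ^ (x + y - w) * qb q (x + y) w = qb q (Suc x + y) z"
    proof (cases "w \<le> x + y")
      case True then show ?thesis using Suc qb_Suc_Suc'[OF True] by simp
    next
      case False then show ?thesis using Suc by simp
    qed
    finally show ?thesis by simp
  qed
qed

text \<open>Both sides are the q-trinomial coefficient with parts k, s and p - k - s.\<close>

lemma qb_trinomial: "qb q p (k + s) * qb q (k + s) k = qb q p k * qb q (p - k) s"
  using qpoch_self_nonzero[OF q] by (auto simp: qb_def divide_simps)

text \<open>Expanding the last binomial by Vandermonde and regrouping by \<open>t = k + s\<close> leaves two Vandermonde sums.\<close>
lemma qb_saalschutz:
  "(\<Sum>k\<le>m. q ^ (k * (k + c)) * qb q p k * qb q r (k + c) * qb q (p + r + m - k) (p + r))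
   = qb q (m + p + c) m * qb q (m + r) (m + c)"
proof -
  have nz: "qpoch q q i \<noteq> 0" for i by (rule qpoch_self_nonzero[OF q])
  \<comment> \<open>The coefficient \<open>[p + r + m - k; p + r]\<close> is reflected to the lower
    entry m - k and its top is split as (p - k) + (r + m), so that \<open>qb_trinomial\<close> can
    merge the factors with tops p and p - k.\<close>
  define u where "u k s = q ^ (k * (k + c)) * qb q p k * qb q r (k + c) *
      (q ^ (s * (r + k + s)) * qb q (p - k) s * qb q (r + m) (m - k - s))" for k s
  have "(\<Sum>k\<le>m. q ^ (k * (k + c)) * qb q p k * qb q r (k + c) * qb q (p + r + m - k) (p + r))
      = (\<Sum>k\<le>m. \<Sum>s\<le>m - k. u k s)"
  proof (rule sum.cong[OF refl])
    fix k assume k: "k \<in> {..m}"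
    show "q ^ (k * (k + c)) * qb q p k * qb q r (k + c) * qb q (p + r + m - k) (p + r) = (\<Sum>s\<le>m - k. u k s)"
    proof (cases "k \<le> p")
      case True
      have 1: "qb q (p + r + m - k) (p + r) = qb q ((p - k) + (r + m)) (m - k)"
        using qb_symmetric[of "m - k" "p + r + m - k" q] True k by (simp add: add.commute add.left_commute)
      have 2: "r + m + s - (m - k) = r + k + s" for s using k by auto
      show ?thesis unfolding 1 qb_vandermonde u_def sum_distrib_left 2 by (simp add: algebra_simps)
    qed (simp add: u_def)
  qed
  also have "\<dots> = (\<Sum>t\<le>m. \<Sum>k\<le>t. u k (t - k))"
  proof -
    have "(\<Sum>k\<le>m. \<Sum>s\<le>m - k. u k s) = (\<Sum>(k, s)\<in>(SIGMA k:{..m}. {..m - k}). u k s)"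
      by (rule sum.Sigma) auto
    also have "(SIGMA k:{..m}. {..m - k}) = {(k, s). k + s \<le> m}" by auto
    finally show ?thesis by (simp add: sum.triangle_reindex_eq)
  qed
  also have "\<dots> = (\<Sum>t\<le>m. q ^ (t * (t + c)) * qb q p t * qb q (m + c) (m - t)) * qb q (m + r) (m + c)"
    unfolding sum_distrib_right
  proof (rule sum.cong[OF refl])
    fix t assume t: "t \<in> {..m}"
    \<comment> \<open>For fixed t, the index s = t - k makes the inner sum a q-Vandermonde sum with
      top t + r and lower entry t + c.\<close>
    have "(\<Sum>k\<le>t. u k (t - k)) = (\<Sum>k\<le>t. q ^ (t * (t + c)) * qb q p t * qb q (r + m) (m - t) *
        (q ^ ((t - k) * (r + (t - k) - (t + c))) * qb q t (t - k) * qb q r (t + c - (t - k))))"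
    proof (rule sum.cong[OF refl])
      fix k assume "k \<in> {..t}"
      then obtain s where s: "t = k + s" using le_Suc_ex by auto
      show "u k (t - k) = q ^ (t * (t + c)) * qb q p t * qb q (r + m) (m - t) *
        (q ^ ((t - k) * (r + (t - k) - (t + c))) * qb q t (t - k) * qb q r (t + c - (t - k)))"
      proof (cases "k + c \<le> r")
        case True
        then obtain d where d: "r = k + c + d" using le_Suc_ex by blast
        have e: "k * (k + c) + s * (r + k + s) = t * (t + c) + s * (r + s - (t + c))"
          unfolding s d by (simp add: algebra_simps)
        have y: "qb q t s = qb q t k" using qb_symmetric[of k t q] s by simp
        have z: "q ^ (k * (k + c)) * q ^ (s * (r + k + s)) = q ^ (t * (t + c)) * q ^ (s * (r + s - (t + c)))"
          by (metis e power_add)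
        have w: "qb q p k * qb q (p - k) s = qb q p t * qb q t s" unfolding y
          using qb_trinomial[of p k s] s by simp
        have sx: "t - k = s" "t + c - s = k + c" "m - k - s = m - t" using s by auto
        have "u k s = (q ^ (k * (k + c)) * q ^ (s * (r + k + s))) * (qb q p k * qb q (p - k) s) * (qb q r (k + c) * qb q (r + m) (m - t))"
          unfolding u_def sx by (simp add: mult_ac)
        also have "\<dots> = q ^ (t * (t + c)) * qb q p t * qb q (r + m) (m - t) *
          (q ^ (s * (r + s - (t + c))) * qb q t s * qb q r (k + c))"
          unfolding z w by (simp add: mult_ac)
        finally show ?thesis unfolding sx .
      next
        case False
        then show ?thesis using s by (simp add: u_def)
      qed
    qed
    also have "\<dots> = q ^ (t * (t + c)) * qb q p t * qb q (r + m) (m - t) *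
        (\<Sum>k\<le>t. (q ^ (k * (r + k - (t + c))) * qb q t k * qb q r (t + c - k)))"
      unfolding sum_distrib_left[symmetric]
      by (rule arg_cong[where f="\<lambda>x. _ * x"], rule sum.reindex_bij_witness[of _ "\<lambda>k. t - k" "\<lambda>k. t - k"]) auto
    also have "(\<Sum>k\<le>t. (q ^ (k * (r + k - (t + c))) * qb q t k * qb q r (t + c - k)))
       = (\<Sum>k\<le>t + c. (q ^ (k * (r + k - (t + c))) * qb q t k * qb q r (t + c - k)))"
      by (rule sum.mono_neutral_left) auto
    also have "\<dots> = qb q (t + r) (t + c)" by (simp add: qb_vandermonde)
    \<comment> \<open>The exchange isolates \<open>[m + r; m + c]\<close>, which is free of t, and
      leaves a second q-Vandermonde sum.\<close>
    also have "q ^ (t * (t + c)) * qb q p t * qb q (r + m) (m - t) * qb q (t + r) (t + c)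
       = q ^ (t * (t + c)) * qb q p t * qb q (m + c) (m - t) * qb q (m + r) (m + c)"
    proof -
      have "qb q (r + m) (m - t) * qb q (t + r) (t + c) = qb q (m + c) (m - t) * qb q (m + r) (m + c)"
        using t nz by (auto simp: qb_def divide_simps add.commute)
      then show ?thesis by (simp add: mult.assoc)
    qed
    finally show "(\<Sum>k\<le>t. u k (t - k)) = q ^ (t * (t + c)) * qb q p t * qb q (m + c) (m - t) * qb q (m + r) (m + c)" .
  qed
  also have "(\<Sum>t\<le>m. q ^ (t * (t + c)) * qb q p t * qb q (m + c) (m - t)) = qb q (p + (m + c)) m"
  proof -
    have "m + c + t - m = t + c" for t by simp
    then show ?thesis by (simp add: qb_vandermonde[of p] add.commute)
  qed
  finally show ?thesis by (simp add: add.commute add.left_commute)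
qed

end

section \<open>The Burge transform\<close>

definition qburge :: "complex \<Rightarrow> nat \<Rightarrow> nat \<Rightarrow> int \<Rightarrow> int \<Rightarrow> complex" where
  "qburge q y x a b = qbinom q (int y + a - b) (int x + a) * qbinom q (int y - a + b) (int x - a)"

lemma qburge_uminus: "qburge q y x (- a) (- b) = qburge q y x a b"
  by (simp add: qburge_def mult.commute algebra_simps)

lemma qbinom_symmetric: "qbinom q n (n - k) = qbinom q n k"
  by (auto simp: qbinom_def mult.commute)

lemma qbinom_eq_0: "k < 0 \<or> n < k \<Longrightarrow> qbinom q n k = 0"
  by (auto simp: qbinom_def)

text \<open>For \<open>x * y = q\<close> this is \<open>(- x) ^ j * q ^ (j (j - 1) / 2)\<close>, written without negative powers so that
  \<open>q = 0\<close> is covered.\<close>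
definition jterm :: "complex \<Rightarrow> complex \<Rightarrow> complex \<Rightarrow> int \<Rightarrow> complex" where
  "jterm x y q j = (-1) ^ nat \<bar>j\<bar> * (if 0 \<le> j then x else y) ^ nat \<bar>j\<bar> * q ^ (nat \<bar>j\<bar> choose 2)"

lemma jterm_uminus: "jterm x y q (- j) = jterm y x q j"
  by (cases "j = 0") (auto simp: jterm_def)

text \<open>Formally j -> j + 1 multiplies the term by - x q^j; the extra q^(n - j) turns this into
  q^n and avoids negative exponents. For negative j it is x * y = q that cancels one factor
  y.\<close>

lemma jterm_add_1:
  assumes "x * y = q" "\<bar>j\<bar> \<le> int n"
  shows "jterm x y q (j + 1) * q ^ nat (int n - j) = - x * q ^ n * jterm x y q j"
proof (cases "0 \<le> j")
  case True
  then obtain i where i: "j = int i" using nonneg_int_cases by blast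
  then obtain d where d: "n = i + d" using assms(2) le_Suc_ex by auto
  have 1: "nat \<bar>j + 1\<bar> = Suc i" "nat \<bar>j\<bar> = i" "nat (int n - j) = d" using i d by auto
  have 2: "Suc i choose 2 = (i choose 2) + i" by (simp add: numeral_2_eq_2)
  have "jterm x y q (j + 1) = (-1) ^ Suc i * x ^ Suc i * q ^ ((i choose 2) + i)"
    unfolding jterm_def 1 2 using True by simp
  moreover have "jterm x y q j = (-1) ^ i * x ^ i * q ^ (i choose 2)"
    unfolding jterm_def 1 using True by simp
  ultimately show ?thesis unfolding 1 unfolding d power_add power_Suc
    by (simp only: mult_minus_left mult_minus_right mult_1_left minus_minus mult_ac)
next
  case False
  then have "j = - int (Suc (nat (- j) - 1))" by linarith
  then obtain i where i: "j = - int (Suc i)" ..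
  have 1: "nat \<bar>j + 1\<bar> = i" "nat \<bar>j\<bar> = Suc i" "nat (int n - j) = Suc i + n" using i by auto
  have 2: "Suc i choose 2 = (i choose 2) + i" by (simp add: numeral_2_eq_2)
  have 3: "(if 0 \<le> j + 1 then x else y) ^ i = y ^ i" using i by (cases i) auto
  have "jterm x y q (j + 1) = (-1) ^ i * y ^ i * q ^ (i choose 2)"
    unfolding jterm_def 1 3 ..
  moreover have "jterm x y q j = (-1) ^ Suc i * y ^ Suc i * q ^ ((i choose 2) + i)"
    unfolding jterm_def 1 2 using False by simp
  ultimately show ?thesis unfolding 1 power_add power_Suc unfolding assms(1)[symmetric]
    by (simp only: mult_minus_left mult_minus_right mult_1_left minus_minus mult_ac)
qed

lemma jterm_minus_1:
  assumes "x * y = q" "\<bar>j\<bar> \<le> int n"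
  shows "jterm x y q (j - 1) * q ^ nat (int n + j) = - y * q ^ n * jterm x y q j"
  using jterm_add_1[of y x q "-j" n] assms
    jterm_uminus[of y x q "j - 1"] jterm_uminus[of y x q j] by (simp add: mult.commute)

section \<open>The finite Jacobi triple product\<close>

context
  fixes q :: complex
  assumes q: "norm q < 1"
begin

text \<open>One q-Pascal rule followed by the other. The top entry has to grow by two, since the
  central coefficients \<open>[2n; n + j]\<close> keep their shape only under such a double
  step.\<close>

lemma qbinom_three_term:
  assumes "-1 \<le> l" "l \<le> int N + 1"
  shows "qbinom q (int N + 2) (l + 1) = (1 + q ^ (N + 1)) * qbinom q (int N) l
    + q ^ nat (int N + 1 - l) * qbinom q (int N) (l - 1) + q ^ nat (l + 1) * qbinom q (int N) (l + 1)"
proof -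
  consider "l = -1" | "l = 0" | i where "l = int (Suc i)" "i < N" | "l = int N + 1"
  proof -
    assume a: "l = -1 \<Longrightarrow> thesis" "l = 0 \<Longrightarrow> thesis" "\<And>i. l = int (Suc i) \<Longrightarrow> i < N \<Longrightarrow> thesis" "l = int N + 1 \<Longrightarrow> thesis"
    show thesis
    proof (cases "l \<le> 0 \<or> l = int N + 1")
      case True then show ?thesis using a assms by linarith
    next
      case False
      then have "l = int (Suc (nat (l - 1)))" "nat (l - 1) < N" using assms by linarith+
      then show ?thesis using a(3) by blast
    qed
  qed
  then show ?thesis
  proof cases
    case 1
    then show ?thesis by (simp add: qbinom_nat qbinom_eq_0 q)
  next
    case 2
    have "qb q (N + 2) 1 = 1 + q * (q ^ N + qb q N 1)"
      using qb_Suc_Suc[OF q, of "Suc N" 0] qb_Suc_Suc'[OF q, of 0 N] by (simp add: q)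
    then show ?thesis using 2
      by (simp add: qbinom_nat qbinom_eq_0 q nat_add_distrib) (simp add: algebra_simps)
  next
    case (3 i)
    have n: "nat (int N + 2) = Suc (Suc N)" "nat (l + 1) = Suc (Suc i)" "nat l = Suc i" "nat (l - 1) = i" "nat (int N + 1 - l) = N - i"
      using 3 by auto
    have "qb q (Suc (Suc N)) (Suc (Suc i)) = (1 + q ^ (N + 1)) * qb q N (Suc i)
         + q ^ (N - i) * qb q N i + q ^ Suc (Suc i) * qb q N (Suc (Suc i))"
    proof -
      have "q ^ Suc (Suc i) * q ^ (N - Suc i) = q ^ (N + 1)"
        unfolding power_add[symmetric] using 3 by (intro arg_cong[where f="\<lambda>n. q ^ n"]) auto
      then have "q ^ Suc (Suc i) * (q ^ (N - Suc i) * qb q N (Suc i)) = q ^ (N + 1) * qb q N (Suc i)"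
        by (metis mult.assoc)
      then show ?thesis
        unfolding qb_Suc_Suc[OF q, of "Suc N" "Suc i"]
        using 3(2) qb_Suc_Suc'[OF q, of i N] qb_Suc_Suc'[OF q, of "Suc i" N]
        by (simp add: distrib_left distrib_right add_ac)
    qed
    then show ?thesis using 3 n by (simp add: qbinom_nat)
  next
    case 4
    then have "nat (int N + 2) = N + 2" "nat (l + 1) = N + 2" by auto
    then show ?thesis using 4 by (simp add: qbinom_nat qbinom_eq_0 q)
  qed
qed

text \<open>By \<open>qbinom_three_term\<close>, passing from n to n + 1 multiplies the sum by 1 +
  q^(2n+1) - x q^n - y q^n, which is (1 - x q^n)(1 - y q^n) because x * y = q.\<close>

lemma finite_jacobi_triple:
  assumes xy: "x * y = q"
  shows "(\<Sum>j=-int n..int n. jterm x y q j * qbinom q (2 * int n) (int n + j)) = qpoch x q n * qpoch y q n"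
proof (induction n)
  case 0
  then show ?case by (simp add: jterm_def qbinom_def numeral_2_eq_2)
next
  case (Suc n)
  let ?I = "{-int n..int n}" and ?J = "{-int (Suc n)..int (Suc n)}"
  define f where "f j = jterm x y q j * qbinom q (2 * int n) (int n + j)" for j
  have z: "qbinom q (2 * int n) (int n + j) = 0" if "j \<notin> ?I" for j
    using that by (intro qbinom_eq_0) auto
  have S: "sum f ?I = qpoch x q n * qpoch y q n" using Suc unfolding f_def .
  have "(\<Sum>j\<in>?J. jterm x y q j * qbinom q (2 * int (Suc n)) (int (Suc n) + j))
      = (\<Sum>j\<in>?J. (1 + q ^ (2 * n + 1)) * f j)
      + (\<Sum>j\<in>?J. jterm x y q j * q ^ nat (int n + 1 - j) * qbinom q (2 * int n) (int n + j - 1))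
      + (\<Sum>j\<in>?J. jterm x y q j * q ^ nat (int n + 1 + j) * qbinom q (2 * int n) (int n + j + 1))"
    unfolding sum.distrib[symmetric]
  proof (rule sum.cong[OF refl])
    fix j assume j: "j \<in> ?J"
    have e: "2 * int (Suc n) = int (2 * n) + 2" "int (Suc n) + j = (int n + j) + 1" by simp_all
    show "jterm x y q j * qbinom q (2 * int (Suc n)) (int (Suc n) + j) = (1 + q ^ (2 * n + 1)) * f j
      + jterm x y q j * q ^ nat (int n + 1 - j) * qbinom q (2 * int n) (int n + j - 1)
      + jterm x y q j * q ^ nat (int n + 1 + j) * qbinom q (2 * int n) (int n + j + 1)"
      unfolding e using qbinom_three_term[of "int n + j" "2 * n"] j
      by (simp add: f_def algebra_simps)
  qed
  also have "(\<Sum>j\<in>?J. (1 + q ^ (2 * n + 1)) * f j) = (1 + q ^ (2 * n + 1)) * sum f ?I"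
    unfolding sum_distrib_left using z by (intro sum.mono_neutral_right) (auto simp: f_def)
  also have "(\<Sum>j\<in>?J. jterm x y q j * q ^ nat (int n + 1 - j) * qbinom q (2 * int n) (int n + j - 1))
      = (\<Sum>j\<in>{1 - int n..1 + int n}. jterm x y q j * q ^ nat (int n + 1 - j) * qbinom q (2 * int n) (int n + j - 1))"
    by (rule sum.mono_neutral_right) (auto intro!: qbinom_eq_0)
  also have "\<dots> = (\<Sum>j\<in>?I. - x * q ^ n * f j)"
  proof (rule sum.reindex_bij_witness[of _ "\<lambda>j. j + 1" "\<lambda>j. j - 1"])
    fix j assume "j \<in> {1 - int n..1 + int n}"
    then have "jterm x y q j * q ^ nat (int n + 1 - j) = - x * q ^ n * jterm x y q (j - 1)"
      using jterm_add_1[OF xy, of "j - 1" n] by (simp add: abs_le_iff) (simp add: algebra_simps)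
    then show "- x * q ^ n * f (j - 1) = jterm x y q j * q ^ nat (int n + 1 - j) * qbinom q (2 * int n) (int n + j - 1)"
      by (simp add: f_def algebra_simps)
  qed auto
  also have "(\<Sum>j\<in>?J. jterm x y q j * q ^ nat (int n + 1 + j) * qbinom q (2 * int n) (int n + j + 1))
      = (\<Sum>j\<in>{-1 - int n..-1 + int n}. jterm x y q j * q ^ nat (int n + 1 + j) * qbinom q (2 * int n) (int n + j + 1))"
    by (rule sum.mono_neutral_right) (auto intro!: qbinom_eq_0)
  also have "\<dots> = (\<Sum>j\<in>?I. - y * q ^ n * f j)"
  proof (rule sum.reindex_bij_witness[of _ "\<lambda>j. j - 1" "\<lambda>j. j + 1"])
    fix j assume "j \<in> {-1 - int n..-1 + int n}"
    then have "jterm x y q j * q ^ nat (int n + 1 + j) = - y * q ^ n * jterm x y q (j + 1)"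
      using jterm_minus_1[OF xy, of "j + 1" n] by (simp add: abs_le_iff) (simp add: algebra_simps)
    then show "- y * q ^ n * f (j + 1) = jterm x y q j * q ^ nat (int n + 1 + j) * qbinom q (2 * int n) (int n + j + 1)"
      by (simp add: f_def algebra_simps)
  qed auto
  finally have "(\<Sum>j\<in>?J. jterm x y q j * qbinom q (2 * int (Suc n)) (int (Suc n) + j))
      = (1 + q ^ (2 * n + 1)) * sum f ?I + - x * q ^ n * sum f ?I + - y * q ^ n * sum f ?I"
    unfolding sum_distrib_left[symmetric] .
  moreover have "q ^ (2 * n + 1) = x * y * q ^ n * q ^ n"
    by (simp add: xy power_add mult_2)
  ultimately show ?case
    by (simp only: S qpoch_Suc) (simp add: algebra_simps)
qed

section \<open>The transform as an instance of the q-Saalschuetz sum\<close>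

text \<open>With i = k + A this is \<open>qb_saalschutz\<close> for p = x + B - A, r = x + A - B, m
  = y - x - A and c = 2 A, where p + r = 2 x. If p, r or m would be negative, both sides
  vanish.\<close>

lemma qburge_transform_nonneg:
  "(\<Sum>i\<le>x. q ^ (i\<^sup>2) * qbinom q (int y + int x - int i) (2 * int x) * qburge q x i (int A) (int B))
    = q ^ (A\<^sup>2) * qburge q y x (int A + int B) (int A)"
proof (cases "x + A \<le> y \<and> A \<le> x + B \<and> B \<le> x + A")
  case False
  have "q ^ (i\<^sup>2) * qbinom q (int y + int x - int i) (2 * int x) * qburge q x i (int A) (int B) = 0" for i
    using False by (auto simp: qburge_def qbinom_def)
  moreover have "qburge q y x (int A + int B) (int A) = 0"
    using False by (auto simp: qburge_def qbinom_def)
  ultimately show ?thesis by (simp only: mult_zero_right sum.neutral_const)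
next
  case True
  define p r m where "p = x + B - A" and "r = x + A - B" and "m = y - x - A"
  let ?f = "\<lambda>i. q ^ (i\<^sup>2) * qbinom q (int y + int x - int i) (2 * int x) * qburge q x i (int A) (int B)"
  let ?g = "\<lambda>k. q ^ (k * (k + 2 * A)) * qb q p k * qb q r (k + 2 * A) * qb q (p + r + m - k) (p + r)"
  have pr: "p + r = 2 * x" using True by (simp add: p_def r_def)
  \<comment> \<open>Below A the second factor of \<open>qburge\<close> vanishes, above y - x the
    coefficient with lower entry 2 x does.\<close>
  have "sum ?f {..x} = sum ?f {i. A \<le> i \<and> i \<le> x \<and> i \<le> y - x}"
    by (rule sum.mono_neutral_right) (auto simp: qburge_def qbinom_def)
  also have "\<dots> = (\<Sum>k\<in>{k. k \<le> m \<and> k + A \<le> x}. q ^ (A\<^sup>2) * ?g k)"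
  proof (rule sum.reindex_bij_witness[of _ "\<lambda>k. k + A" "\<lambda>i. i - A"])
    fix i assume i: "i \<in> {i. A \<le> i \<and> i \<le> x \<and> i \<le> y - x}"
    then obtain k where k: "i = k + A" by (metis (mono_tags) mem_Collect_eq le_add_diff_inverse2)
    have "q ^ (i\<^sup>2) = q ^ (A\<^sup>2) * q ^ (k * (k + 2 * A))"
      unfolding power_add[symmetric]
      by (intro arg_cong[where f="\<lambda>n. q ^ n"]) (simp add: k power2_eq_square algebra_simps)
    moreover have "qbinom q (int y + int x - int i) (2 * int x) = qb q (p + r + m - k) (p + r)"
    proof -
      have "int y + int x - int i = int (p + r + m - k)" "2 * int x = int (p + r)"
        using i k pr True by (auto simp: m_def of_nat_diff)
      then show ?thesis by (simp only: qbinom_of_nat)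
    qed
    moreover have "qburge q x i (int A) (int B) = qb q p k * qb q r (k + 2 * A)"
    proof -
      have "int x + int A - int B = int r" "int i + int A = int (k + 2 * A)"
           "int x - int A + int B = int p" "int i - int A = int k"
        using i k True by (auto simp: p_def r_def of_nat_diff)
      then show ?thesis by (simp only: qbinom_of_nat qburge_def mult.commute)
    qed
    ultimately show "q ^ (A\<^sup>2) * ?g (i - A) = ?f i"
      using k by simp
  qed (use True in \<open>auto simp: m_def\<close>)
  \<comment> \<open>Summands with k + A > x vanish, because then k + 2 A > r.\<close>
  also have "\<dots> = (\<Sum>k\<le>m. q ^ (A\<^sup>2) * ?g k)"
    by (rule sum.mono_neutral_left) (auto simp: r_def)
  also have "\<dots> = q ^ (A\<^sup>2) * (qb q (m + p + 2 * A) m * qb q (m + r) (m + 2 * A))"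
    unfolding sum_distrib_left[symmetric] by (subst qb_saalschutz[OF q]) simp
  also have "qb q (m + p + 2 * A) m * qb q (m + r) (m + 2 * A) = qburge q y x (int A + int B) (int A)"
  proof -
    have "int y + (int A + int B) - int A = int (m + p + 2 * A)"
         "int x + (int A + int B) = int (m + p + 2 * A) - int m"
         "int y - (int A + int B) + int A = int (m + r)"
         "int x - (int A + int B) = int (m + r) - int (m + 2 * A)"
      using True by (auto simp: m_def p_def r_def of_nat_diff)
    then show ?thesis unfolding qburge_def by (simp only: qbinom_symmetric qbinom_of_nat)
  qed
  finally show ?thesis .
qed

text \<open>In the iteration a and b are Fibonacci multiples of one j, hence of equal sign;
  \<open>qburge_uminus\<close> carries negative pairs to positive ones.\<close>

lemma qburge_transform:
  assumes "0 \<le> a \<and> 0 \<le> b \<or> a \<le> 0 \<and> b \<le> 0"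
  shows "(\<Sum>i\<le>x. q ^ (i\<^sup>2) * qbinom q (int y + int x - int i) (2 * int x) * qburge q x i a b)
    = q ^ nat (a\<^sup>2) * qburge q y x (a + b) a"
proof -
  have *: "nat (a\<^sup>2) = (nat \<bar>a\<bar>)\<^sup>2" by (simp add: nat_power_eq[symmetric])
  show ?thesis
  proof (cases "0 \<le> a \<and> 0 \<le> b")
    case True
    then show ?thesis using qburge_transform_nonneg[of y x "nat a" "nat b"] * by simp
  next
    case False
    with assms have s: "a \<le> 0" "b \<le> 0" by auto
    have "qburge q x i a b = qburge q x i (int (nat \<bar>a\<bar>)) (int (nat \<bar>b\<bar>))" for i
      using qburge_uminus[of q x i a b] s by simp
    moreover have "qburge q y x (a + b) a = qburge q y x (int (nat \<bar>a\<bar>) + int (nat \<bar>b\<bar>)) (int (nat \<bar>a\<bar>))"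
      using qburge_uminus[of q y x "a + b" a] s by simp
    ultimately show ?thesis using qburge_transform_nonneg[of y x "nat \<bar>a\<bar>" "nat \<bar>b\<bar>"] * by simp
  qed
qed

section \<open>The kernel with equal parameters\<close>

text \<open>q-Vandermonde for the second factor, with y = (x + j) + (m - j), m = y - x, and reversed
  index s = x - k. The q-factorials regroup so that j survives only in \<open>[2s; s + j]\<close>,
  which the finite triple product can sum over j.\<close>

lemma qburge_diagonal_expand_nonneg:
  assumes "x \<le> y"
  shows "qburge q y x (int j) (int j) = (\<Sum>s\<le>min x (y - x). q ^ ((x - s) * (y - x - s)) * qpoch q q y /
     (qpoch q q (x - s) * qpoch q q (y - x - s) * qpoch q q (2 * s)) * qbinom q (2 * int s) (int s + int j))"
    (is "_ = sum ?h _")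
proof (cases "j \<le> x \<and> x + j \<le> y")
  case False
  then have "qburge q y x (int j) (int j) = 0" by (auto simp: qburge_def qbinom_def)
  moreover have "?h s = 0" if "s \<in> {..min x (y - x)}" for s
  proof -
    have "s < j" using False that assms by auto
    then show ?thesis by (simp add: qbinom_eq_0)
  qed
  ultimately show ?thesis by (metis (no_types, lifting) sum.neutral)
next
  case True
  have nz: "qpoch q q i \<noteq> 0" for i by (rule qpoch_self_nonzero[OF q])
  define m where "m = y - x"
  have y: "y = x + m" using assms by (simp add: m_def)
  have jm: "j \<le> m" "j \<le> x" using True by (auto simp: m_def)
  have "qburge q y x (int j) (int j) = qb q y (x + j) * qb q ((x + j) + (m - j)) (x - j)"
  proof -
    have "int x + int j = int (x + j)" "int x - int j = int (x - j)" "x + j + (m - j) = y"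
      using jm y by auto
    then show ?thesis unfolding qburge_def
      by (simp only: qbinom_of_nat add_diff_cancel_right' diff_add_cancel)
  qed
  also have "\<dots> = (\<Sum>k\<le>x - j. qb q y (x + j) * (q ^ (k * (m - j + k - (x - j))) * qb q (x + j) k * qb q (m - j) (x - j - k)))"
    unfolding qb_vandermonde[OF q, of "x + j"] sum_distrib_left ..
  also have "\<dots> = (\<Sum>s\<in>{j..x}. qb q y (x + j) * (q ^ ((x - s) * (m - s)) * qb q (x + j) (x - s) * qb q (m - j) (s - j)))"
  proof (rule sum.reindex_bij_witness[of _ "\<lambda>s. x - s" "\<lambda>k. x - k"])
    fix k assume "k \<in> {..x - j}"
    then have "x - (x - k) = k" "m - j + k - (x - j) = m - (x - k)" "x - j - k = x - k - j"
      using jm by auto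
    then show "qb q y (x + j) * (q ^ ((x - (x - k)) * (m - (x - k))) * qb q (x + j) (x - (x - k)) * qb q (m - j) (x - k - j))
      = qb q y (x + j) * (q ^ (k * (m - j + k - (x - j))) * qb q (x + j) k * qb q (m - j) (x - j - k))" by simp
  qed (use jm in auto)
  also have "\<dots> = (\<Sum>s\<in>{j..min x m}. qb q y (x + j) * (q ^ ((x - s) * (m - s)) * qb q (x + j) (x - s) * qb q (m - j) (s - j)))"
    using jm by (intro sum.mono_neutral_right) auto
  also have "\<dots> = sum ?h {j..min x m}"
  proof (rule sum.cong[OF refl])
    fix s assume s: "s \<in> {j..min x m}"
    have e: "2 * int s = int (2 * s)" "int s + int j = int (s + j)" by auto
    have c: "x + j \<le> y" "x - s \<le> x + j" "s - j \<le> m - j" "s + j \<le> 2 * s"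
      using s jm y by auto
    have d: "y - x = m" "y - (x + j) = m - j" "x + j - (x - s) = s + j" "m - j - (s - j) = m - s" "2 * s - (s + j) = s - j"
      using s jm y by auto
    show "qb q y (x + j) * (q ^ ((x - s) * (m - s)) * qb q (x + j) (x - s) * qb q (m - j) (s - j)) = ?h s"
      unfolding e qbinom_of_nat qb_def d using c nz by (simp add: divide_simps)
  qed
  also have "\<dots> = sum ?h {..min x m}"
    by (rule sum.mono_neutral_left) (auto intro!: qbinom_eq_0)
  finally show ?thesis by (simp add: m_def)
qed

lemma qburge_diagonal_expand:
  assumes "x \<le> y"
  shows "qburge q y x j j = (\<Sum>s\<le>min x (y - x). q ^ ((x - s) * (y - x - s)) * qpoch q q y /
     (qpoch q q (x - s) * qpoch q q (y - x - s) * qpoch q q (2 * s)) * qbinom q (2 * int s) (int s + j))"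
proof (cases "0 \<le> j")
  case True
  then show ?thesis using qburge_diagonal_expand_nonneg[OF assms, of "nat j"] by simp
next
  case False
  have "qbinom q (2 * int s) (int s + j) = qbinom q (2 * int s) (int s + int (nat (-j)))" for s
    using qbinom_symmetric[of q "2 * int s" "int s + j"] False by (simp add: algebra_simps)
  then show ?thesis using qburge_diagonal_expand_nonneg[OF assms, of "nat (-j)"] False
      qburge_uminus[of q y x j j] by simp
qed

text \<open>By the finite triple product with \<open>x = q\<close>, \<open>y = 1\<close> only the index \<open>s = 0\<close> of the expansion survives.\<close>
lemma sum_jterm_qburge_diagonal:
  assumes "x \<le> N"
  shows "(\<Sum>j=-int N..int N. jterm q 1 q j * qburge q y x j j) = q ^ (x * (y - x)) * qb q y x"
proof (cases "x \<le> y")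
  case False
  then show ?thesis by (auto simp: qburge_def qbinom_def intro!: sum.neutral)
next
  case True
  define W where "W s = q ^ ((x - s) * (y - x - s)) * qpoch q q y /
     (qpoch q q (x - s) * qpoch q q (y - x - s) * qpoch q q (2 * s))" for s
  have inner: "(\<Sum>j=-int N..int N. jterm q 1 q j * qbinom q (2 * int s) (int s + j)) = (if s = 0 then 1 else 0)"
    if "s \<le> min x (y - x)" for s
  proof -
    \<comment> \<open>Since s <= x <= N, the window contains every j with \<open>[2s; s + j]\<close>
      nonzero.\<close>
    have "(\<Sum>j=-int N..int N. jterm q 1 q j * qbinom q (2 * int s) (int s + j))
       = (\<Sum>j=-int s..int s. jterm q 1 q j * qbinom q (2 * int s) (int s + j))"
      using assms that by (intro sum.mono_neutral_right) (auto intro!: qbinom_eq_0)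
    also have "\<dots> = qpoch q q s * qpoch 1 q s" by (rule finite_jacobi_triple) simp
    also have "\<dots> = (if s = 0 then 1 else 0)"
      by (auto simp: qpoch_def intro!: bexI[of _ 0])
    finally show ?thesis .
  qed
  have "(\<Sum>j=-int N..int N. jterm q 1 q j * qburge q y x j j)
     = (\<Sum>s\<le>min x (y - x). W s * (\<Sum>j=-int N..int N. jterm q 1 q j * qbinom q (2 * int s) (int s + j)))"
    unfolding qburge_diagonal_expand[OF True] W_def[symmetric] sum_distrib_left
    by (rule trans[OF sum.swap]) (simp only: mult.left_commute)
  also have "\<dots> = (\<Sum>s\<le>min x (y - x). if s = 0 then W s else 0)"
    by (rule sum.cong[OF refl]) (simp add: inner)
  also have "\<dots> = W 0" by simp
  finally show ?thesis using True by (simp add: W_def qb_def)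
qed

end

section \<open>The finite multisum\<close>

text \<open>y and x are the last two entries chosen, s counts the sums still to be performed. The
  recursive clause is the operator of \<open>qburge_transform\<close>, the base the value in
  \<open>sum_jterm_qburge_diagonal\<close>.\<close>

fun burge_chain :: "complex \<Rightarrow> nat \<Rightarrow> nat \<Rightarrow> nat \<Rightarrow> complex" where
  "burge_chain q 0 y x = q ^ (x * (y - x)) * qb q y x"
| "burge_chain q (Suc s) y x =
    (\<Sum>i\<le>x. q ^ (i\<^sup>2) * qbinom q (int y + int x - int i) (2 * int x) * burge_chain q s x i)"

lemma burge_chain_eq_0: "y < x \<Longrightarrow> burge_chain q s y x = 0"
  by (cases s) (auto simp: qbinom_eq_0)

text \<open>The parameters start at (F_2 j, F_1 j), so s transforms collect the squares of F_2, ...,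
  F_(s+1) only; the - 1 in the exponent is the missing square of F_1. One window N for all x <= N
  allows the sums over i and j to be exchanged.\<close>

lemma burge_chain_eq_sum:
  assumes q: "norm q < 1" and "x \<le> N"
  shows "burge_chain q s y x = (\<Sum>j=-int N..int N. jterm q 1 q j * q ^ (nat (j\<^sup>2) * (fib (s + 2) * fib (s + 1) - 1)) *
    qburge q y x (int (fib (s + 2)) * j) (int (fib (s + 1)) * j))"
  using \<open>x \<le> N\<close>
proof (induction s arbitrary: y x)
  case 0
  then show ?case using sum_jterm_qburge_diagonal[OF q 0] by (simp add: numeral_2_eq_2)
next
  case (Suc s)
  define c where "c j = jterm q 1 q j * q ^ (nat (j\<^sup>2) * (fib (s + 2) * fib (s + 1) - 1))" for j
  define a b where "a j = int (fib (s + 2)) * j" and "b j = int (fib (s + 1)) * j" for j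
  define w where "w i = q ^ (i\<^sup>2) * qbinom q (int y + int x - int i) (2 * int x)" for i
  have "burge_chain q (Suc s) y x = (\<Sum>i\<le>x. w i * (\<Sum>j=-int N..int N. c j * qburge q x i (a j) (b j)))"
    using Suc.prems by (simp add: Suc.IH w_def c_def a_def b_def)
  also have "\<dots> = (\<Sum>j=-int N..int N. c j * (\<Sum>i\<le>x. w i * qburge q x i (a j) (b j)))"
    unfolding sum_distrib_left by (rule trans[OF sum.swap]) (simp only: mult.left_commute)
  also have "\<dots> = (\<Sum>j=-int N..int N. jterm q 1 q j * q ^ (nat (j\<^sup>2) * (fib (Suc s + 2) * fib (Suc s + 1) - 1)) *
    qburge q y x (int (fib (Suc s + 2)) * j) (int (fib (Suc s + 1)) * j))"
  proof (rule sum.cong[OF refl])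
    fix j
    have sgn: "0 \<le> a j \<and> 0 \<le> b j \<or> a j \<le> 0 \<and> b j \<le> 0"
      unfolding a_def b_def by (cases "0 \<le> j") (auto simp: mult_le_0_iff)
    have sq: "nat ((a j)\<^sup>2) = nat (j\<^sup>2) * (fib (s + 2))\<^sup>2"
      unfolding a_def power_mult_distrib
      by (subst nat_mult_distrib) (auto simp: nat_power_eq)
    have ab: "a j + b j = int (fib (Suc s + 2)) * j" "a j = int (fib (Suc s + 1)) * j"
      by (auto simp: a_def b_def algebra_simps)
    have "fib (s + 2) * fib (s + 1) - 1 + (fib (s + 2))\<^sup>2 = fib (Suc s + 2) * fib (Suc s + 1) - 1"
    proof -
      \<comment> \<open>Positivity is required because the - 1 is a subtraction of natural
        numbers.\<close>
      have "0 < fib (s + 2) * fib (s + 1)" using fib_neq_0_nat by simp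
      moreover have "fib (Suc s + 2) * fib (Suc s + 1) = fib (s + 2) * fib (s + 1) + (fib (s + 2))\<^sup>2"
        by (simp add: power2_eq_square algebra_simps)
      ultimately show ?thesis by (simp only: Nat.add_diff_assoc2 Suc_leI One_nat_def)
    qed
    then have e: "q ^ (nat (j\<^sup>2) * (fib (s + 2) * fib (s + 1) - 1)) * q ^ nat ((a j)\<^sup>2)
      = q ^ (nat (j\<^sup>2) * (fib (Suc s + 2) * fib (Suc s + 1) - 1))"
      unfolding sq by (metis distrib_left power_add)
    have "c j * (\<Sum>i\<le>x. w i * qburge q x i (a j) (b j)) = c j * (q ^ nat ((a j)\<^sup>2) * qburge q y x (a j + b j) (a j))"
      unfolding w_def by (simp only: qburge_transform[OF q sgn])
    also have "\<dots> = jterm q 1 q j * (q ^ (nat (j\<^sup>2) * (fib (s + 2) * fib (s + 1) - 1)) * q ^ nat ((a j)\<^sup>2)) * qburge q y x (a j + b j) (a j)"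
      by (simp only: c_def mult.assoc)
    finally show "c j * (\<Sum>i\<le>x. w i * qburge q x i (a j) (b j)) = jterm q 1 q j * q ^ (nat (j\<^sup>2) * (fib (Suc s + 2) * fib (Suc s + 1) - 1)) *
      qburge q y x (int (fib (Suc s + 2)) * j) (int (fib (Suc s + 1)) * j)"
      unfolding e ab(1) by (simp only: ab(2)[symmetric])
  qed
  finally show ?case .
qed

section \<open>Unrolling the recursion into one sum over a box\<close>

definition bounded_seqs :: "nat \<Rightarrow> nat \<Rightarrow> (nat \<Rightarrow> nat) set" where
  "bounded_seqs t N = {m. (\<forall>i. m i \<le> N) \<and> (\<forall>i. i < 1 \<or> t < i \<longrightarrow> m i = 0)}"

lemma bounded_seqs_0: "bounded_seqs 0 N = {\<lambda>_. 0}"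
  by (auto simp: bounded_seqs_def fun_eq_iff Suc_le_eq not_less)

lemma bij_betw_bounded_seqs_Suc:
  "bij_betw (\<lambda>(m, x). m(Suc t := x)) (bounded_seqs t N \<times> {..N}) (bounded_seqs (Suc t) N)"
  by (rule bij_betw_byWitness[where f' = "\<lambda>m. (m(Suc t := 0), m (Suc t))"])
     (auto simp: bounded_seqs_def fun_eq_iff)

lemma finite_bounded_seqs: "finite (bounded_seqs t N)"
proof (induction t)
  case (Suc t)
  then show ?case using bij_betw_finite[OF bij_betw_bounded_seqs_Suc[of t N]] by simp
qed (simp add: bounded_seqs_0)

lemma sum_bounded_seqs_Suc:
  fixes f :: "(nat \<Rightarrow> nat) \<Rightarrow> 'a :: comm_monoid_add"
  shows "sum f (bounded_seqs (Suc t) N) = (\<Sum>m\<in>bounded_seqs t N. \<Sum>x\<le>N. f (m(Suc t := x)))"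
  using sum.reindex_bij_betw[OF bij_betw_bounded_seqs_Suc[of t N], of f]
  by (simp add: sum.cartesian_product split_def)

text \<open>The shift by one makes \<open>chain_weight\<close> at j >= 2 the j-th factor of the
  product in the theorem; j = 0 and j = 1 give the two factors containing L.\<close>

definition prefixed :: "nat \<Rightarrow> (nat \<Rightarrow> nat) \<Rightarrow> nat \<Rightarrow> nat" where
  "prefixed L m i = (if i = 0 then 2 * L else if i = 1 then L else m (i - 1))"

definition chain_weight :: "complex \<Rightarrow> nat \<Rightarrow> (nat \<Rightarrow> nat) \<Rightarrow> nat \<Rightarrow> complex" where
  "chain_weight q L m j = qbinom q (int (prefixed L m j) + int (prefixed L m (j + 1)) - int (prefixed L m (j + 2)))
     (2 * int (prefixed L m (j + 1)))"

text \<open>Letting each sum run up to L instead of the preceding entry turns nested sums into a sum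
  over a box; the added terms vanish by \<open>burge_chain_eq_0\<close>.\<close>

lemma burge_chain_unroll:
  assumes "t \<le> s"
  shows "burge_chain q s (2 * L) L = (\<Sum>m\<in>bounded_seqs t L. q ^ (\<Sum>i=1..t. (m i)\<^sup>2) * (\<Prod>j<t. chain_weight q L m j) *
    burge_chain q (s - t) (prefixed L m t) (prefixed L m (t + 1)))"
  using assms
proof (induction t)
  case 0
  then show ?case by (simp add: bounded_seqs_0 prefixed_def)
next
  case (Suc t)
  show ?case
    unfolding sum_bounded_seqs_Suc
    unfolding Suc.IH[OF Suc_leD[OF Suc.prems]]
  proof (rule sum.cong[OF refl])
    fix m assume m: "m \<in> bounded_seqs t L"
    define e where "e = prefixed L m"
    obtain r where r: "s - t = Suc r" "s - Suc t = r" using Suc.prems by (metis Suc_diff_Suc Suc_le_lessD)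
    have eL: "e (t + 1) \<le> L" using m by (auto simp: e_def prefixed_def bounded_seqs_def)
    have p1: "prefixed L (m(Suc t := x)) i = e i" if "i \<le> t + 1" for i x
      using that by (auto simp: e_def prefixed_def)
    have p2: "prefixed L (m(Suc t := x)) (t + 2) = x" for x
      by (simp add: prefixed_def)
    have w: "(\<Prod>j<t. chain_weight q L (m(Suc t := x)) j) = (\<Prod>j<t. chain_weight q L m j)" for x
      by (rule prod.cong[OF refl]) (simp add: chain_weight_def p1 e_def)
    have sq: "(\<Sum>i=1..t. ((m(Suc t := x)) i)\<^sup>2) = (\<Sum>i=1..t. (m i)\<^sup>2)" for x
      by (rule sum.cong) auto
    have "burge_chain q (s - t) (e t) (e (t + 1)) = (\<Sum>x\<le>e (t + 1). q ^ (x\<^sup>2) *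
         qbinom q (int (e t) + int (e (t + 1)) - int x) (2 * int (e (t + 1))) * burge_chain q r (e (t + 1)) x)"
      by (simp add: r)
    also have "\<dots> = (\<Sum>x\<le>L. q ^ (x\<^sup>2) *
         qbinom q (int (e t) + int (e (t + 1)) - int x) (2 * int (e (t + 1))) * burge_chain q r (e (t + 1)) x)"
      using eL by (intro sum.mono_neutral_left) (auto simp: burge_chain_eq_0)
    finally have b: "burge_chain q (s - t) (e t) (e (t + 1)) = \<dots>" .
    show "q ^ (\<Sum>i=1..t. (m i)\<^sup>2) * (\<Prod>j<t. chain_weight q L m j) *
        burge_chain q (s - t) (prefixed L m t) (prefixed L m (t + 1))
      = (\<Sum>x\<le>L. q ^ (\<Sum>i=1..Suc t. ((m(Suc t := x)) i)\<^sup>2) * (\<Prod>j<Suc t. chain_weight q L (m(Suc t := x)) j) *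
        burge_chain q (s - Suc t) (prefixed L (m(Suc t := x)) (Suc t)) (prefixed L (m(Suc t := x)) (Suc t + 1)))"
      unfolding e_def[symmetric] b sum_distrib_left
    proof (rule sum.cong[OF refl])
      fix x
      have 1: "(\<Sum>i=1..Suc t. ((m(Suc t := x)) i)\<^sup>2) = (\<Sum>i=1..t. (m i)\<^sup>2) + x\<^sup>2"
        using sq by simp
      have 2: "chain_weight q L (m(Suc t := x)) t = qbinom q (int (e t) + int (e (t + 1)) - int x) (2 * int (e (t + 1)))"
        unfolding chain_weight_def p2 by (simp add: p1)
      have 3: "prefixed L (m(Suc t := x)) (Suc t) = e (t + 1)" "prefixed L (m(Suc t := x)) (Suc t + 1) = x"
        using p1[of "t + 1"] p2 by simp_all
      show "q ^ (\<Sum>i=1..t. (m i)\<^sup>2) * (\<Prod>j<t. chain_weight q L m j) * (q ^ x\<^sup>2 *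
          qbinom q (int (e t) + int (e (t + 1)) - int x) (2 * int (e (t + 1))) * burge_chain q r (e (t + 1)) x)
        = q ^ (\<Sum>i=1..Suc t. ((m(Suc t := x)) i)\<^sup>2) * (\<Prod>j<Suc t. chain_weight q L (m(Suc t := x)) j) *
          burge_chain q (s - Suc t) (prefixed L (m(Suc t := x)) (Suc t)) (prefixed L (m(Suc t := x)) (Suc t + 1))"
        unfolding 1 3 prod.lessThan_Suc w 2 r power_add by (simp only: mult_ac)
    qed
  qed
qed

text \<open>Full unrolling with k - 2 levels, compared with \<open>burge_chain_eq_sum\<close>. The
  last square q^(m_(k-2)^2) and the base power q^(m_(k-2) (m_(k-3) - m_(k-2))) merge into q^(m_(k-3)
  m_(k-2)), which leaves k - 3 squares.\<close>

lemma fibonacci_chain_finite: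
  assumes q: "norm q < 1" and k: "k \<ge> 4"
  shows "(\<Sum>m\<in>bounded_seqs (k - 2) L. q ^ ((\<Sum>i=1..k-3. (m i)\<^sup>2) + m (k-3) * m (k-2)) *
      qbinom q (3 * int L - int (m 1)) (2 * int L) * qbinom q (int L + int (m 1) - int (m 2)) (2 * int (m 1)) *
      (\<Prod>j=2..k-3. qbinom q (int (m (j-1)) + int (m j) - int (m (j+1))) (2 * int (m j))) *
      qbinom q (int (m (k-3))) (int (m (k-2))))
    = (\<Sum>j=-int L..int L. jterm q 1 q j * q ^ (nat (j\<^sup>2) * (fib k * fib (k - 1) - 1)) *
      qburge q (2 * L) L (int (fib k) * j) (int (fib (k - 1)) * j))"
proof -
  obtain t where t: "k = t + 4" using k le_Suc_ex by (metis add.commute)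
  have kk: "k - 2 + 2 = k" "k - 2 + 1 = k - 1" using k by auto
  have "(\<Sum>j=-int L..int L. jterm q 1 q j * q ^ (nat (j\<^sup>2) * (fib k * fib (k - 1) - 1)) *
      qburge q (2 * L) L (int (fib k) * j) (int (fib (k - 1)) * j)) = burge_chain q (k - 2) (2 * L) L"
    using burge_chain_eq_sum[OF q order_refl, of "k - 2" "2 * L" L] unfolding kk by simp
  also have "\<dots> = (\<Sum>m\<in>bounded_seqs (k - 2) L. q ^ (\<Sum>i=1..k - 2. (m i)\<^sup>2) * (\<Prod>j<k - 2. chain_weight q L m j) *
    burge_chain q 0 (prefixed L m (k - 2)) (prefixed L m (k - 1)))"
    unfolding burge_chain_unroll[OF order_refl] kk by simp
  also have "\<dots> = (\<Sum>m\<in>bounded_seqs (k - 2) L. q ^ ((\<Sum>i=1..k-3. (m i)\<^sup>2) + m (k-3) * m (k-2)) *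
      qbinom q (3 * int L - int (m 1)) (2 * int L) * qbinom q (int L + int (m 1) - int (m 2)) (2 * int (m 1)) *
      (\<Prod>j=2..k-3. qbinom q (int (m (j-1)) + int (m j) - int (m (j+1))) (2 * int (m j))) *
      qbinom q (int (m (k-3))) (int (m (k-2))))"
  proof (rule sum.cong[OF refl])
    fix m :: "nat \<Rightarrow> nat"
    define P where "P = (\<Prod>j=2..k-3. qbinom q (int (m (j-1)) + int (m j) - int (m (j+1))) (2 * int (m j)))"
    have "{..<k - 2} = insert 0 (insert 1 {2..k-3})" using t by auto
    then have "(\<Prod>j<k - 2. chain_weight q L m j) = chain_weight q L m 0 * (chain_weight q L m 1 * (\<Prod>j=2..k-3. chain_weight q L m j))"
      by simp
    also have "(\<Prod>j=2..k-3. chain_weight q L m j) = P"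
      unfolding P_def by (rule prod.cong[OF refl]) (auto simp: chain_weight_def prefixed_def)
    also have "chain_weight q L m 0 = qbinom q (3 * int L - int (m 1)) (2 * int L)"
      by (simp add: chain_weight_def prefixed_def)
    also have "chain_weight q L m 1 = qbinom q (int L + int (m 1) - int (m 2)) (2 * int (m 1))"
      by (simp add: chain_weight_def prefixed_def numeral_2_eq_2)
    finally have w: "(\<Prod>j<k - 2. chain_weight q L m j) = qbinom q (3 * int L - int (m 1)) (2 * int L) *
        (qbinom q (int L + int (m 1) - int (m 2)) (2 * int (m 1)) * P)" .
    have e: "prefixed L m (k - 2) = m (k - 3)" "prefixed L m (k - 1) = m (k - 2)"
      using t by (auto simp: prefixed_def numeral_3_eq_3)
    have s: "(\<Sum>i=1..k - 2. (m i)\<^sup>2) = (\<Sum>i=1..k - 3. (m i)\<^sup>2) + (m (k - 2))\<^sup>2"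
      using t by (simp add: numeral_3_eq_3)
    have "q ^ (m (k-2))\<^sup>2 * burge_chain q 0 (m (k-3)) (m (k-2)) = q ^ (m (k-3) * m (k-2)) * qbinom q (int (m (k-3))) (int (m (k-2)))"
    proof (cases "m (k-2) \<le> m (k-3)")
      case True
      then obtain d where d: "m (k-3) = m (k-2) + d" using le_Suc_ex by blast
      then have "q ^ (m (k-2))\<^sup>2 * q ^ (m (k-2) * (m (k-3) - m (k-2))) = q ^ (m (k-3) * m (k-2))"
        by (simp add: power_add[symmetric] power2_eq_square algebra_simps)
      then show ?thesis unfolding qbinom_of_nat by (simp add: mult.assoc[symmetric])
    qed (simp add: qbinom_of_nat)
    note last = this
    have "q ^ (\<Sum>i=1..k - 2. (m i)\<^sup>2) * (\<Prod>j<k - 2. chain_weight q L m j) *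
        burge_chain q 0 (prefixed L m (k - 2)) (prefixed L m (k - 1))
      = q ^ (\<Sum>i=1..k-3. (m i)\<^sup>2) * (\<Prod>j<k - 2. chain_weight q L m j) *
        (q ^ (m (k-2))\<^sup>2 * burge_chain q 0 (m (k-3)) (m (k-2)))"
      unfolding e s power_add by (simp only: mult_ac)
    then show "q ^ (\<Sum>i=1..k - 2. (m i)\<^sup>2) * (\<Prod>j<k - 2. chain_weight q L m j) *
        burge_chain q 0 (prefixed L m (k - 2)) (prefixed L m (k - 1))
      = q ^ ((\<Sum>i=1..k-3. (m i)\<^sup>2) + m (k-3) * m (k-2)) *
      qbinom q (3 * int L - int (m 1)) (2 * int L) * qbinom q (int L + int (m 1) - int (m 2)) (2 * int (m 1)) *
      P * qbinom q (int (m (k-3))) (int (m (k-2)))"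
      unfolding last w power_add by (simp only: mult_ac)
  qed
  finally show ?thesis by simp
qed

section \<open>Passage to the limit\<close>

text \<open>Dominated convergence with summand and finite window both varying with n. A finite F
  carries the sum of h up to e/4, so the window sums off F and the tail of g are at most e/4 each,
  while on F convergence is termwise.\<close>

lemma tannery_windows:
  fixes f :: "nat \<Rightarrow> 'a \<Rightarrow> 'b :: banach"
  assumes h: "h summable_on A"
    and bound: "\<And>n x. x \<in> A \<Longrightarrow> norm (f n x) \<le> h x"
    and lim: "\<And>x. x \<in> A \<Longrightarrow> (\<lambda>n. f n x) \<longlonglongrightarrow> g x"
    and W: "\<And>n. finite (W n)" "\<And>n. W n \<subseteq> A"
    and exh: "\<And>x. x \<in> A \<Longrightarrow> eventually (\<lambda>n. x \<in> W n) sequentially"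
  shows "g summable_on A" "(\<lambda>n. \<Sum>x\<in>W n. f n x) \<longlonglongrightarrow> infsum g A"
proof -
  have gh: "norm (g x) \<le> h x" if "x \<in> A" for x
    using tendsto_norm[OF lim[OF that]] bound[OF that] by (intro tendsto_upperbound) auto
  have h0: "0 \<le> h x" if "x \<in> A" for x using gh[OF that] norm_ge_zero order_trans by blast
  have ga: "(\<lambda>x. norm (g x)) summable_on A"
    by (rule summable_on_comparison_test[OF h]) (auto simp: gh)
  then show gs: "g summable_on A" by (rule abs_summable_summable)
  show "(\<lambda>n. \<Sum>x\<in>W n. f n x) \<longlonglongrightarrow> infsum g A"
  proof (rule LIMSEQ_I)
    fix e :: real assume e: "0 < e"
    obtain F where F: "finite F" "F \<subseteq> A" "dist (sum h F) (infsum h A) \<le> e / 4"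
      using infsum_finite_approximation[OF h, of "e / 4"] e by auto
    have tail: "sum h G \<le> e / 4" if "finite G" "G \<subseteq> A - F" for G
    proof -
      have "sum h (F \<union> G) \<le> infsum h A"
        using that F h h0 by (intro finite_sum_le_infsum) auto
      moreover have "sum h (F \<union> G) = sum h F + sum h G"
        using that F by (intro sum.union_disjoint) auto
      ultimately show ?thesis using F(3) unfolding dist_real_def by linarith
    qed
    have tg: "norm (infsum g A - sum g F) \<le> e / 4"
    proof -
      have hs: "(h has_sum (infsum h A - sum h F)) (A - F)"
        using F h by (intro has_sum_Diff) auto
      have "(g has_sum (infsum g A - sum g F)) (A - F)"
        using F gs by (intro has_sum_Diff) auto
      then have "norm (infsum g A - sum g F) \<le> infsum h A - sum h F"
        using hs by (rule norm_infsum_le) (simp add: gh)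
      then show ?thesis using F(3) unfolding dist_real_def by linarith
    qed
    have "(\<lambda>n. \<Sum>x\<in>F. f n x) \<longlonglongrightarrow> sum g F"
      using lim F by (intro tendsto_sum) auto
    then have "eventually (\<lambda>n. norm (sum (f n) F - sum g F) < e / 4) sequentially"
      using e unfolding tendsto_iff dist_norm by (metis zero_less_divide_iff zero_less_numeral)
    moreover have "eventually (\<lambda>n. \<forall>x\<in>F. x \<in> W n) sequentially"
      using F exh by (intro eventually_ball_finite) auto
    ultimately have "eventually (\<lambda>n. norm (sum (f n) (W n) - infsum g A) < e) sequentially"
    proof eventually_elim
      case (elim n)
      have "sum (f n) (W n) = sum (f n) (W n - F) + sum (f n) F"
        using W elim by (intro sum.subset_diff) auto
      moreover have "norm (sum (f n) (W n - F)) \<le> e / 4"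
      proof -
        have "norm (sum (f n) (W n - F)) \<le> sum h (W n - F)"
          using W by (intro sum_norm_le bound) auto
        also have "\<dots> \<le> e / 4" using W by (intro tail) auto
        finally show ?thesis .
      qed
      ultimately have "sum (f n) (W n) - infsum g A
          = sum (f n) (W n - F) + (sum (f n) F - sum g F) - (infsum g A - sum g F)" by simp
      also have "norm \<dots> \<le> norm (sum (f n) (W n - F)) + norm (sum (f n) F - sum g F) + norm (infsum g A - sum g F)"
        by (intro order_trans[OF norm_triangle_ineq4] add_right_mono norm_triangle_ineq)
      also have "\<dots> < e"
        using \<open>norm (sum (f n) (W n - F)) \<le> e / 4\<close> elim tg e by linarith
      finally show ?case .
    qed
    then show "\<exists>no. \<forall>n\<ge>no. norm (sum (f n) (W n) - infsum g A) < e"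
      by (simp add: eventually_sequentially)
  qed
qed

section \<open>Infinite products and limits of q-binomials\<close>

lemma qpoch_convergent_prod:
  fixes x q :: complex
  assumes "norm q < 1"
  shows "convergent_prod (\<lambda>i. 1 - x * q ^ i)"
proof -
  have "summable (\<lambda>i. norm x * norm q ^ i)"
    using assms by (intro summable_mult summable_geometric) simp
  then have "summable (\<lambda>i. norm ((1 - x * q ^ i) - 1))"
    by (simp add: norm_mult norm_power)
  then have "abs_convergent_prod (\<lambda>i. 1 - x * q ^ i)"
    by (rule summable_imp_abs_convergent_prod)
  then show ?thesis by (rule abs_convergent_prod_imp_convergent_prod)
qed

lemma qpoch_tendsto:
  assumes "norm q < 1"
  shows "(\<lambda>n. qpoch x q n) \<longlonglongrightarrow> qpochinf x q"
proof -
  have "(\<lambda>n. qpoch x q (Suc n)) \<longlonglongrightarrow> qpochinf x q"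
    using convergent_prod_LIMSEQ[OF qpoch_convergent_prod[OF assms, of x]]
    by (simp add: qpoch_def qpochinf_def lessThan_Suc_atMost)
  then show ?thesis by (rule LIMSEQ_imp_Suc)
qed

lemma qpochinf_self_nonzero:
  assumes "norm q < 1"
  shows "qpochinf q q \<noteq> 0"
  unfolding qpochinf_def
proof (rule prodinf_nonzero[OF qpoch_convergent_prod[OF assms]])
  fix i
  show "1 - q * q ^ i \<noteq> 0"
    using qpoch_self_nonzero[OF assms, of "Suc i"] by (simp add: qpoch_Suc)
qed

text \<open>(q)_n tends to a nonzero limit, so it and its inverse are bounded. A constant valid for
  all indices makes the majorants independent of L.\<close>

lemma qbinom_bounded:
  assumes "norm q < 1"
  obtains C where "C \<ge> 1" "\<And>n k. norm (qbinom q n k) \<le> C"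
proof -
  note t = qpoch_tendsto[OF assms, of q]
  obtain A where A: "0 < A" "\<And>n. norm (qpoch q q n) \<le> A"
    using BseqE[OF convergent_imp_Bseq[OF convergentI[OF t]]] by metis
  obtain B where B: "0 < B" "\<And>n. norm (inverse (qpoch q q n)) \<le> B"
    using BseqE[OF convergent_imp_Bseq[OF convergentI[OF tendsto_inverse[OF t qpochinf_self_nonzero[OF assms]]]]]
    by metis
  have "norm (qbinom q n k) \<le> max 1 (A * (B * B))" for n k
  proof (cases "0 \<le> k \<and> k \<le> n")
    case True
    then have "norm (qbinom q n k) = norm (qpoch q q (nat n)) * (norm (inverse (qpoch q q (nat k))) * norm (inverse (qpoch q q (nat (n - k)))))"
      by (simp add: qbinom_def norm_mult norm_divide norm_inverse divide_inverse)
    also have "\<dots> \<le> A * (B * B)"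
      using A B by (intro mult_mono) (auto simp: less_imp_le intro!: mult_nonneg_nonneg)
    finally show ?thesis by simp
  next
    case False
    then show ?thesis by (auto simp: qbinom_def)
  qed
  then show ?thesis using that[of "max 1 (A * (B * B))"] by simp
qed

lemma qpoch_nat_tendsto:
  assumes "norm q < 1" "filterlim f at_top sequentially"
  shows "(\<lambda>L. qpoch q q (nat (f L))) \<longlonglongrightarrow> qpochinf q q"
  using filterlim_compose[OF qpoch_tendsto[OF assms(1)] filterlim_compose[OF filterlim_nat_sequentially assms(2)]] .

lemma qbinom_tendsto_central:
  assumes q: "norm q < 1" and k: "filterlim k at_top sequentially"
    and nk: "filterlim (\<lambda>L. n L - k L) at_top sequentially"
  shows "(\<lambda>L. qbinom q (n L) (k L)) \<longlonglongrightarrow> 1 / qpochinf q q"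
proof -
  have ev: "eventually (\<lambda>L. 0 \<le> k L) sequentially" "eventually (\<lambda>L. 0 \<le> n L - k L) sequentially"
    using k nk unfolding filterlim_at_top by blast+
  have n: "filterlim n at_top sequentially"
  proof (rule filterlim_at_top_mono[OF k])
    show "eventually (\<lambda>L. k L \<le> n L) sequentially" using ev(2) by eventually_elim simp
  qed
  have "(\<lambda>L. qpoch q q (nat (n L)) / (qpoch q q (nat (k L)) * qpoch q q (nat (n L - k L))))
      \<longlonglongrightarrow> qpochinf q q / (qpochinf q q * qpochinf q q)"
    by (intro tendsto_intros qpoch_nat_tendsto q n k nk) (simp add: qpochinf_self_nonzero q)
  then have "(\<lambda>L. qpoch q q (nat (n L)) / (qpoch q q (nat (k L)) * qpoch q q (nat (n L - k L))))
      \<longlonglongrightarrow> 1 / qpochinf q q" by (simp add: qpochinf_self_nonzero q)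
  then show ?thesis
  proof (rule Lim_transform_eventually)
    show "eventually (\<lambda>L. qpoch q q (nat (n L)) / (qpoch q q (nat (k L)) * qpoch q q (nat (n L - k L))) = qbinom q (n L) (k L)) sequentially"
      using ev by eventually_elim (simp add: qbinom_def)
  qed
qed

lemma qbinom_tendsto_top:
  assumes q: "norm q < 1" and n: "filterlim n at_top sequentially" and k: "0 \<le> k"
  shows "(\<lambda>L. qbinom q (n L) k) \<longlonglongrightarrow> 1 / qpoch q q (nat k)"
proof -
  have ev: "eventually (\<lambda>L. k \<le> n L) sequentially"
    using n by (auto simp: filterlim_at_top)
  have nk: "filterlim (\<lambda>L. n L - k) at_top sequentially"
    unfolding filterlim_at_top
  proof
    fix Z
    have "eventually (\<lambda>L. Z + k \<le> n L) sequentially"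
      using n unfolding filterlim_at_top by blast
    then show "eventually (\<lambda>L. Z \<le> n L - k) sequentially"
      by eventually_elim simp
  qed
  have "(\<lambda>L. qpoch q q (nat (n L)) / (qpoch q q (nat k) * qpoch q q (nat (n L - k))))
      \<longlonglongrightarrow> qpochinf q q / (qpoch q q (nat k) * qpochinf q q)"
    by (intro tendsto_intros qpoch_nat_tendsto q n nk) (simp add: qpochinf_self_nonzero qpoch_self_nonzero q)
  then have "(\<lambda>L. qpoch q q (nat (n L)) / (qpoch q q (nat k) * qpoch q q (nat (n L - k))))
      \<longlonglongrightarrow> 1 / qpoch q q (nat k)" by (simp add: qpochinf_self_nonzero q)
  then show ?thesis
  proof (rule Lim_transform_eventually)
    show "eventually (\<lambda>L. qpoch q q (nat (n L)) / (qpoch q q (nat k) * qpoch q q (nat (n L - k))) = qbinom q (n L) k) sequentially"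
      using ev by eventually_elim (simp add: qbinom_def k)
  qed
qed

lemma filterlim_int_affine:
  fixes c d :: int
  assumes "0 < c"
  shows "filterlim (\<lambda>L. c * int L + d) at_top sequentially"
  unfolding filterlim_at_top
proof
  fix Z
  have "Z \<le> c * int L + d" if "nat (Z - d) \<le> L" for L
  proof -
    have "Z - d \<le> int L" using that by linarith
    also have "int L \<le> c * int L" using assms mult_right_mono[of 1 c "int L"] by simp
    finally show ?thesis by simp
  qed
  then show "eventually (\<lambda>L. Z \<le> c * int L + d) sequentially"
    by (rule eventually_sequentiallyI)
qed

text \<open>The lower entries L + a, L - a and the gaps L - b, L + b all diverge, whatever a and b
  are.\<close>

lemma qburge_tendsto:
  assumes q: "norm q < 1"
  shows "(\<lambda>L. qburge q (2 * L) L a b) \<longlonglongrightarrow> 1 / qpochinf q q * (1 / qpochinf q q)"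
  unfolding qburge_def
proof (intro tendsto_mult qbinom_tendsto_central q)
  show "filterlim (\<lambda>L. int L + a) at_top sequentially"
    using filterlim_int_affine[of 1 a] by simp
  show "filterlim (\<lambda>L. int L - a) at_top sequentially"
    using filterlim_int_affine[of 1 "-a"] by simp
  show "filterlim (\<lambda>L. int (2 * L) + a - b - (int L + a)) at_top sequentially"
    using filterlim_int_affine[of 1 "-b"] by (simp add: algebra_simps)
  show "filterlim (\<lambda>L. int (2 * L) - a + b - (int L - a)) at_top sequentially"
    using filterlim_int_affine[of 1 b] by (simp add: algebra_simps)
qed

section \<open>The infinite Jacobi triple product and its theta parameters\<close>

lemma summable_on_int_power:
  fixes r :: real
  assumes "0 \<le> r" "r < 1"
  shows "(\<lambda>j::int. r ^ nat \<bar>j\<bar>) summable_on UNIV"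
proof -
  have s: "(\<lambda>n. r ^ n) summable_on UNIV"
    using assms by (intro summable_nonneg_imp_summable_on summable_geometric) auto
  have "(\<lambda>j::int. r ^ nat \<bar>j\<bar>) summable_on range int"
    by (subst summable_on_reindex) (auto simp: o_def s)
  moreover have "(\<lambda>j::int. r ^ nat \<bar>j\<bar>) summable_on range (\<lambda>n. - int n)"
    by (subst summable_on_reindex) (auto simp: o_def s inj_on_def)
  ultimately have "(\<lambda>j::int. r ^ nat \<bar>j\<bar>) summable_on (range int \<union> range (\<lambda>n. - int n))"
    by (rule summable_on_union)
  also have "range int \<union> range (\<lambda>n. - int n) = UNIV"
  proof -
    have "j \<in> range int \<union> range (\<lambda>n. - int n)" for j
      by (cases j rule: int_cases2) auto
    then show ?thesis by blast
  qed
  finally show ?thesis .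
qed

lemma eventually_in_int_window: "eventually (\<lambda>n. j \<in> {-int n..int n}) sequentially"
  by (rule eventually_sequentiallyI[of "nat \<bar>j\<bar>"]) auto

lemma norm_jterm_le:
  assumes "norm x \<le> r" "norm y \<le> r" "norm q \<le> 1"
  shows "norm (jterm x y q j) \<le> r ^ nat \<bar>j\<bar>"
proof -
  have "norm (jterm x y q j) = norm (if 0 \<le> j then x else y) ^ nat \<bar>j\<bar> * norm q ^ (nat \<bar>j\<bar> choose 2)"
    by (simp add: jterm_def norm_mult norm_power)
  also have "\<dots> \<le> r ^ nat \<bar>j\<bar> * 1"
    using assms order_trans[OF norm_ge_zero assms(1)]
    by (intro mult_mono power_mono power_le_one) auto
  finally show ?thesis by simp
qed

text \<open>Limit of \<open>finite_jacobi_triple\<close>: \<open>[2n; n + j]\<close> tends to 1 /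
  (q)_inf for q = x * y, and this constant is then cleared. The larger modulus r of x and y gives
  the majorant r^|j| up to a constant.\<close>

lemma jacobi_triple_product:
  assumes "norm x < 1" "norm y < 1"
  shows "(jterm x y (x * y) has_sum (qpochinf x (x * y) * qpochinf y (x * y) * qpochinf (x * y) (x * y))) UNIV"
proof -
  define q where "q = x * y"
  have q: "norm q < 1"
    using mult_strict_mono'[of "norm x" 1 "norm y" 1] assms by (simp add: q_def norm_mult)
  note nz = qpochinf_self_nonzero[OF q]
  obtain C where C: "C \<ge> 1" "\<And>n k. norm (qbinom q n k) \<le> C" using qbinom_bounded[OF q] by blast
  define r where "r = max (norm x) (norm y)"
  have r: "0 \<le> r" "r < 1" "norm x \<le> r" "norm y \<le> r" using assms by (auto simp: r_def le_max_iff_disj)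
  define f where "f n j = jterm x y q j * qbinom q (2 * int n) (int n + j)" for n j
  have s: "(\<lambda>j. C * r ^ nat \<bar>j\<bar>) summable_on (UNIV :: int set)"
    using summable_on_int_power[OF r(1,2)] by (rule summable_on_cmult_right)
  have b: "norm (f n j) \<le> C * r ^ nat \<bar>j\<bar>" for n j
    unfolding f_def norm_mult using norm_jterm_le[OF r(3,4), of q j] C q r(1)
    by (subst mult.commute) (intro mult_mono, auto)
  have l: "(\<lambda>n. f n j) \<longlonglongrightarrow> jterm x y q j * (1 / qpochinf q q)" for j
    unfolding f_def
  proof (intro tendsto_intros qbinom_tendsto_central q)
    show "filterlim (\<lambda>L. int L + j) at_top sequentially"
      using filterlim_int_affine[of 1 j] by simp
    show "filterlim (\<lambda>L. 2 * int L - (int L + j)) at_top sequentially"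
      using filterlim_int_affine[of 1 "-j"] by (simp add: algebra_simps)
  qed
  note T = tannery_windows[where f = f and A = UNIV and W = "\<lambda>n. {-int n..int n}", OF s b l]
  have T1: "(\<lambda>j. jterm x y q j * (1 / qpochinf q q)) summable_on UNIV"
    and T2: "(\<lambda>n. \<Sum>j=-int n..int n. f n j) \<longlonglongrightarrow> infsum (\<lambda>j. jterm x y q j * (1 / qpochinf q q)) UNIV"
    by (rule T; use eventually_in_int_window in simp)+
  have "(\<lambda>n. \<Sum>j=-int n..int n. f n j) \<longlonglongrightarrow> qpochinf x q * qpochinf y q"
    unfolding f_def finite_jacobi_triple[OF q q_def[symmetric]]
    by (intro tendsto_mult qpoch_tendsto q)
  then have "infsum (\<lambda>j. jterm x y q j * (1 / qpochinf q q)) UNIV = qpochinf x q * qpochinf y q"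
    using T2 LIMSEQ_unique by blast
  then have "((\<lambda>j. jterm x y q j * (1 / qpochinf q q)) has_sum (qpochinf x q * qpochinf y q)) UNIV"
    using has_sum_infsum[OF T1] by simp
  then have "((\<lambda>j. jterm x y q j * (1 / qpochinf q q) * qpochinf q q) has_sum (qpochinf x q * qpochinf y q * qpochinf q q)) UNIV"
    by (rule has_sum_cmult_left)
  then show ?thesis using nz by (simp add: q_def[symmetric])
qed

text \<open>With c = |j| choose 2 one has j^2 = |j| + 2c, hence c + b j^2 = b |j| + (2b + 1) c; the
  additional |j| for j >= 0 accounts for b + 1 against b.\<close>

lemma jterm_quadratic_twist:
  "jterm q 1 q j * q ^ (nat (j\<^sup>2) * b) = jterm (q ^ (b + 1)) (q ^ b) (q ^ (2 * b + 1)) j"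
proof -
  define i c where "i = nat \<bar>j\<bar>" and "c = i choose 2"
  have j2: "nat (j\<^sup>2) = i\<^sup>2" unfolding i_def by (simp add: nat_power_eq[symmetric])
  have sq: "i\<^sup>2 = i + 2 * c"
    unfolding c_def choose_two power2_eq_square by (cases i) auto
  have e1: "i + c + i\<^sup>2 * b = (b + 1) * i + (2 * b + 1) * c"
    and e2: "c + i\<^sup>2 * b = b * i + (2 * b + 1) * c"
    unfolding sq by (simp_all add: algebra_simps)
  show ?thesis
  proof (cases "0 \<le> j")
    case True
    have "q ^ i * q ^ c * q ^ (i\<^sup>2 * b) = q ^ ((b + 1) * i) * q ^ ((2 * b + 1) * c)"
      unfolding power_add[symmetric] e1 ..
    then show ?thesis unfolding jterm_def i_def[symmetric] c_def[symmetric] j2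
      using True by (simp add: power_mult[symmetric] mult.assoc del: power_Suc power_Suc2)
  next
    case False
    have "q ^ c * q ^ (i\<^sup>2 * b) = q ^ (b * i) * q ^ ((2 * b + 1) * c)"
      unfolding power_add[symmetric] e2 ..
    then show ?thesis unfolding jterm_def i_def[symmetric] c_def[symmetric] j2
      using False by (simp add: power_mult[symmetric] mult.assoc del: power_Suc power_Suc2)
  qed
qed

section \<open>Domination of the multisum and the limit of the theta side\<close>

lemma bounded_seqs_exhausts:
  assumes "\<forall>i. (i < 1 \<or> t < i) \<longrightarrow> m i = 0"
  shows "eventually (\<lambda>L. m \<in> bounded_seqs t L) sequentially"
proof (rule eventually_sequentiallyI)
  fix L assume L: "(\<Sum>i\<le>t. m i) \<le> L"
  have "m i \<le> L" for i
  proof (cases "i \<le> t")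
    case True
    then have "m i \<le> (\<Sum>i\<le>t. m i)" by (intro member_le_sum) auto
    then show ?thesis using L by simp
  qed (use assms in simp)
  then show "m \<in> bounded_seqs t L" using assms by (simp add: bounded_seqs_def)
qed

lemma sum_bounded_seqs_prod:
  fixes u :: "nat \<Rightarrow> real"
  shows "(\<Sum>m\<in>bounded_seqs t N. \<Prod>i=1..t. u (m i)) = (\<Sum>x\<le>N. u x) ^ t"
proof (induction t)
  case (Suc t)
  have "(\<Sum>m\<in>bounded_seqs (Suc t) N. \<Prod>i=1..Suc t. u (m i)) = (\<Sum>m\<in>bounded_seqs t N. \<Sum>x\<le>N. (\<Prod>i=1..t. u (m i)) * u x)"
    unfolding sum_bounded_seqs_Suc
  proof (intro sum.cong refl)
    fix m x
    have "(\<Prod>i=1..t. u ((m(Suc t := x)) i)) = (\<Prod>i=1..t. u (m i))" by (rule prod.cong) auto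
    then show "(\<Prod>i=1..Suc t. u ((m(Suc t := x)) i)) = (\<Prod>i=1..t. u (m i)) * u x" by simp
  qed
  also have "\<dots> = (\<Sum>x\<le>N. u x) ^ Suc t"
    unfolding sum_distrib_left[symmetric] sum_distrib_right[symmetric] Suc by simp
  finally show ?case .
qed (simp add: bounded_seqs_0)

text \<open>Every finite set of sequences lies in a box, over which the sum factorizes into a t-th
  power bounded by \<open>suminf u ^ t\<close>.\<close>

lemma summable_on_prod_sequences:
  fixes u :: "nat \<Rightarrow> real" and t :: nat
  assumes u: "\<And>n. 0 \<le> u n" "summable u"
  shows "(\<lambda>m. \<Prod>i=1..t. u (m i)) summable_on {m :: nat \<Rightarrow> nat. \<forall>i. (i < 1 \<or> t < i) \<longrightarrow> m i = 0}"
proof (rule nonneg_bdd_above_summable_on)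
  let ?A = "{m :: nat \<Rightarrow> nat. \<forall>i. (i < 1 \<or> t < i) \<longrightarrow> m i = 0}"
  show "bdd_above (sum (\<lambda>m. \<Prod>i=1..t. u (m i)) ` {F. F \<subseteq> ?A \<and> finite F})"
  proof (rule bdd_aboveI2)
    fix F assume F: "F \<in> {F. F \<subseteq> ?A \<and> finite F}"
    then have "eventually (\<lambda>L. \<forall>m\<in>F. m \<in> bounded_seqs t L) sequentially"
      by (intro eventually_ball_finite) (auto intro!: bounded_seqs_exhausts)
    then obtain L where L: "F \<subseteq> bounded_seqs t L" by (auto simp: eventually_sequentially)
    then have "(\<Sum>m\<in>F. \<Prod>i=1..t. u (m i)) \<le> (\<Sum>m\<in>bounded_seqs t L. \<Prod>i=1..t. u (m i))"
      by (intro sum_mono2 finite_bounded_seqs) (auto intro!: prod_nonneg u)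
    also have "\<dots> = (\<Sum>x\<le>L. u x) ^ t" by (rule sum_bounded_seqs_prod)
    also have "\<dots> \<le> suminf u ^ t"
      using u by (intro power_mono sum_le_suminf sum_nonneg) auto
    finally show "(\<Sum>m\<in>F. \<Prod>i=1..t. u (m i)) \<le> suminf u ^ t" .
  qed
qed (auto intro!: prod_nonneg u)

text \<open>The parameter functions may be arbitrary because the limit of \<open>qburge\<close> is
  independent of them and its bound uniform; the Fibonacci numbers enter through b alone.\<close>

lemma fibonacci_theta_limit:
  fixes b :: nat and \<alpha> \<beta> :: "int \<Rightarrow> int"
  assumes q: "norm q < 1" and b: "0 < b"
  shows "(\<lambda>L. \<Sum>j=-int L..int L. jterm q 1 q j * q ^ (nat (j\<^sup>2) * b) * qburge q (2 * L) L (\<alpha> j) (\<beta> j))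
    \<longlonglongrightarrow> qpochinf (q ^ b) (q ^ (2 * b + 1)) * qpochinf (q ^ (b + 1)) (q ^ (2 * b + 1)) * qpochinf (q ^ (2 * b + 1)) (q ^ (2 * b + 1))
      * (1 / qpochinf q q * (1 / qpochinf q q))"
proof -
  let ?c = "jterm (q ^ (b + 1)) (q ^ b) (q ^ (2 * b + 1))"
  let ?f = "\<lambda>L j. ?c j * qburge q (2 * L) L (\<alpha> j) (\<beta> j)"
  have x: "norm (q ^ (b + 1)) < 1" "norm (q ^ b) < 1" using b by (intro norm_power_less_1[OF q]; simp)+
  have xy: "q ^ (b + 1) * q ^ b = q ^ (2 * b + 1)" by (simp add: power_add[symmetric] mult_2)
  note J = jacobi_triple_product[OF x, unfolded xy]
  obtain C where C: "C \<ge> 1" "\<And>n k. norm (qbinom q n k) \<le> C" using qbinom_bounded[OF q] by blast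
  have s: "(\<lambda>j. C * C * norm (q ^ b) ^ nat \<bar>j\<bar>) summable_on (UNIV :: int set)"
    using summable_on_int_power[of "norm (q ^ b)"] x(2) by (intro summable_on_cmult_right) auto
  have bd: "norm (?f L j) \<le> C * C * norm (q ^ b) ^ nat \<bar>j\<bar>" for L j
  proof -
    have "norm (?c j) \<le> norm (q ^ b) ^ nat \<bar>j\<bar>"
    proof (rule norm_jterm_le)
      show "norm (q ^ (b + 1)) \<le> norm (q ^ b)"
        using q by (simp add: norm_mult mult_left_le_one_le)
      show "norm (q ^ (2 * b + 1)) \<le> 1"
        using norm_power_less_1[OF q, of "2 * b + 1"] by simp
    qed simp
    moreover have "norm (qburge q (2 * L) L (\<alpha> j) (\<beta> j)) \<le> C * C"
      unfolding qburge_def norm_mult using C by (intro mult_mono) (auto intro: order_trans[of 0 1])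
    ultimately show ?thesis
      unfolding norm_mult by (subst mult.commute) (intro mult_mono, auto)
  qed
  note T = tannery_windows[where f = ?f and A = UNIV and W = "\<lambda>n. {-int n..int n}", OF s bd
      tendsto_mult[OF tendsto_const qburge_tendsto[OF q]]]
  have "(\<lambda>L. \<Sum>j=-int L..int L. ?f L j) \<longlonglongrightarrow> infsum (\<lambda>j. ?c j * (1 / qpochinf q q * (1 / qpochinf q q))) UNIV"
    by (rule T; use eventually_in_int_window in simp)
  moreover have "infsum (\<lambda>j. ?c j * (1 / qpochinf q q * (1 / qpochinf q q))) UNIV
    = qpochinf (q ^ (b + 1)) (q ^ (2 * b + 1)) * qpochinf (q ^ b) (q ^ (2 * b + 1)) * qpochinf (q ^ (2 * b + 1)) (q ^ (2 * b + 1))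
      * (1 / qpochinf q q * (1 / qpochinf q q))"
    unfolding infsum_cmult_left' infsumI[OF J] ..
  ultimately show ?thesis
    unfolding jterm_quadratic_twist by (simp only: mult_ac)
qed

theorem theorem1p5:
  fixes q :: complex and k :: nat
  assumes "norm q < 1" and "k \<ge> 4"
  shows "((\<lambda>m :: nat \<Rightarrow> nat.
            q ^ ((\<Sum>i=1..k-3. (m i)\<^sup>2) + m (k-3) * m (k-2)) / qpoch q q (2 * m 1)
            * (\<Prod>j=2..k-3. qbinom q (int (m (j-1)) + int (m j) - int (m (j+1))) (2 * int (m j)))
            * qbinom q (int (m (k-3))) (int (m (k-2))))
         has_sum
           (qpochinf (q ^ (fib k * fib (k-1) - 1)) (q ^ (2 * fib k * fib (k-1) - 1))
            * qpochinf (q ^ (fib k * fib (k-1))) (q ^ (2 * fib k * fib (k-1) - 1))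
            * qpochinf (q ^ (2 * fib k * fib (k-1) - 1)) (q ^ (2 * fib k * fib (k-1) - 1))
            / qpochinf q q))
         {m. \<forall>i. (i < 1 \<or> k - 2 < i) \<longrightarrow> m i = 0}"
    (is "(?g has_sum ?S) ?A")
proof -
  note q = assms(1)
  define b where "b = fib k * fib (k - 1) - 1"
  \<comment> \<open>This secures b > 0, hence |q^b| < 1; F_3 = 2 and k - 1 >= 3 suffice.\<close>
  have "2 \<le> fib k * fib (k - 1)"
  proof -
    have "fib 3 \<le> fib k" "fib 3 \<le> fib (k - 1)" using assms(2) by (intro fib_mono; simp)+
    then show ?thesis using mult_le_mono[of 2 "fib k" 2 "fib (k - 1)"] by (simp add: numeral_3_eq_3)
  qed
  then have b: "0 < b" "fib k * fib (k - 1) = b + 1" "2 * fib k * fib (k - 1) - 1 = 2 * b + 1"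
    unfolding b_def mult.assoc by auto
  define P where "P = (\<lambda>m :: nat \<Rightarrow> nat. \<Prod>j=2..k-3. qbinom q (int (m (j-1)) + int (m j) - int (m (j+1))) (2 * int (m j)))"
  define e where "e = (\<lambda>m :: nat \<Rightarrow> nat. (\<Sum>i=1..k-3. (m i)\<^sup>2) + m (k-3) * m (k-2))"
  define l where "l = (\<lambda>m :: nat \<Rightarrow> nat. qbinom q (int (m (k-3))) (int (m (k-2))))"
  define f where "f = (\<lambda>L m. q ^ e m * qbinom q (3 * int L - int (m 1)) (2 * int L) *
      qbinom q (int L + int (m 1) - int (m 2)) (2 * int (m 1)) * P m * l m)"
  define g where "g = (\<lambda>m. q ^ e m * (1 / qpochinf q q) * (1 / qpoch q q (nat (2 * int (m 1)))) * P m * l m)"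
  obtain C where C: "C \<ge> 1" "\<And>n k. norm (qbinom q n k) \<le> C" using qbinom_bounded[OF q] by blast
  have C0: "0 \<le> C" using C(1) by simp
  \<comment> \<open>One C for each q-binomial: the two containing L, those of the product, and the
    last.\<close>
  let ?K = "C * C * C ^ card {2..k-3} * C"
  have summ: "(\<lambda>m. ?K * (\<Prod>i=1..k-2. norm q ^ (m i)\<^sup>2)) summable_on ?A"
  proof (intro summable_on_cmult_right summable_on_prod_sequences)
    show "summable (\<lambda>n. norm q ^ n\<^sup>2)"
    proof (rule summable_comparison_test'[OF summable_geometric])
      fix n :: nat
      have "n \<le> n\<^sup>2" by (simp add: power2_nat_le_imp_le power2_eq_square)
      then show "norm (norm q ^ n\<^sup>2) \<le> norm q ^ n"
        using q by (simp add: power_decreasing)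
    qed (use q in simp)
  qed simp
  \<comment> \<open>On the support \<open>m (k - 2) \<le> m (k - 3)\<close>, so the mixed term of the exponent dominates \<open>(m (k - 2))\<^sup>2\<close>.\<close>
  have bound: "norm (f L m) \<le> ?K * (\<Prod>i=1..k-2. norm q ^ (m i)\<^sup>2)" for L m
  proof (cases "m (k-2) \<le> m (k-3)")
    case False
    then have "f L m = 0" by (simp add: f_def l_def qbinom_eq_0)
    then show ?thesis using C0 by (auto intro!: mult_nonneg_nonneg prod_nonneg)
  next
    case True
    have k: "k - 2 = Suc (k - 3)" using assms(2) by simp
    have "(\<Sum>i=1..k-2. (m i)\<^sup>2) = (\<Sum>i=1..k-3. (m i)\<^sup>2) + (m (k-2))\<^sup>2"
      unfolding k by simp
    also have "\<dots> \<le> e m"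
      unfolding e_def power2_eq_square using True by simp
    finally have "norm (q ^ e m) \<le> norm q ^ (\<Sum>i=1..k-2. (m i)\<^sup>2)"
      using q by (simp add: norm_power power_decreasing)
    also have "\<dots> = (\<Prod>i=1..k-2. norm q ^ (m i)\<^sup>2)" by (rule power_sum)
    finally have 1: "norm (q ^ e m) \<le> (\<Prod>i=1..k-2. norm q ^ (m i)\<^sup>2)" .
    have 2: "norm (P m) \<le> C ^ card {2..k-3}"
      unfolding P_def by (rule order_trans[OF norm_prod_le]) (intro prod_le_power C C0; simp add: C)
    have "norm (f L m) \<le> (\<Prod>i=1..k-2. norm q ^ (m i)\<^sup>2) * C * C * C ^ card {2..k-3} * C"
      unfolding f_def norm_mult l_def
      using 1 2 C C0 by (intro mult_mono mult_nonneg_nonneg prod_nonneg) auto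
    then show ?thesis by (simp add: mult_ac)
  qed
  have lim: "(\<lambda>L. f L m) \<longlonglongrightarrow> g m" for m
    unfolding f_def g_def
  proof (intro tendsto_mult tendsto_const qbinom_tendsto_central qbinom_tendsto_top q)
    show "filterlim (\<lambda>L. 2 * int L) at_top sequentially"
      using filterlim_int_affine[of 2 0] by simp
    show "filterlim (\<lambda>L. 3 * int L - int (m 1) - 2 * int L) at_top sequentially"
      using filterlim_int_affine[of 1 "- int (m 1)"] by (simp add: algebra_simps)
    show "filterlim (\<lambda>L. int L + int (m 1) - int (m 2)) at_top sequentially"
      using filterlim_int_affine[of 1 "int (m 1) - int (m 2)"] by (simp add: algebra_simps)
  qed simp
  note T = tannery_windows[where f = f and A = ?A and W = "bounded_seqs (k - 2)", OF summ bound lim finite_bounded_seqs]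
  have g1: "g summable_on ?A" and g2: "(\<lambda>L. \<Sum>m\<in>bounded_seqs (k - 2) L. f L m) \<longlonglongrightarrow> infsum g ?A"
    by (rule T; (rule bounded_seqs_exhausts)?; auto simp: bounded_seqs_def)+
  define X where "X = qpochinf (q ^ b) (q ^ (2 * b + 1)) * qpochinf (q ^ (b + 1)) (q ^ (2 * b + 1)) * qpochinf (q ^ (2 * b + 1)) (q ^ (2 * b + 1))"
  have "(\<lambda>L. \<Sum>m\<in>bounded_seqs (k - 2) L. f L m) \<longlonglongrightarrow> X * (1 / qpochinf q q * (1 / qpochinf q q))"
    unfolding f_def e_def P_def l_def fibonacci_chain_finite[OF assms] b_def[symmetric] X_def
    by (rule fibonacci_theta_limit[OF q b(1)])
  with g2 have "infsum g ?A = X * (1 / qpochinf q q * (1 / qpochinf q q))"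
    by (rule LIMSEQ_unique)
  with has_sum_infsum[OF g1] have "(g has_sum (X * (1 / qpochinf q q * (1 / qpochinf q q)))) ?A"
    by (simp only:)
  \<comment> \<open>Multiplication by (q)_inf removes the limit of \<open>[3L - m_1; 2L]\<close> on
    the left and one of the two factors 1 / (q)_inf on the right.\<close>
  then have "((\<lambda>m. g m * qpochinf q q) has_sum (X * (1 / qpochinf q q * (1 / qpochinf q q)) * qpochinf q q)) ?A"
    by (rule has_sum_cmult_left)
  moreover have "g m * qpochinf q q = ?g m" for m
    using qpochinf_self_nonzero[OF q] by (simp add: g_def e_def P_def l_def nat_mult_distrib)
  moreover have "X * (1 / qpochinf q q * (1 / qpochinf q q)) * qpochinf q q = ?S"
    using qpochinf_self_nonzero[OF q] unfolding b(3) b(2) X_def by simp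
  ultimately show ?thesis by (simp only:)
qed

end
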